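(* Let $F$ be a field with at least four elements, and let $\lambda\in F^\times\setminus\{\pm1\}$. Let $\bar f:H_2(SL_2(F),\mathbb{Z})\to K_2(2,F)$ be the natural homomorphism. (1) For all $a,b\in F^\times$, $\bar f(C(a,b)_\lambda)=c(a,b)$. (2) If $a,b\in F^\times$ and furthermore $a,b,ab\notin\{\pm1\}$, then $\bar f(\tilde C(a,b)_\lambda)=c(a,b)$.
   Context: Bar complex: for a group $G$, $\bar F_n(G)$ is the free abelian group on symbols $[g_n|\cdots|g_1]$, with $d_2([g|h])=[g]+[h]-[gh]$; $H_n(G,\mathbb{Z})=H_n(\bar F_\bullet(G))$. $K_2(2,F)$: for a commutative ring $A$, $St(2,A)$ is the group with generators $x_{12}(t),x_{21}(t)$ ($t\in A$) and relations, for $i\ne j$: $x_{ij}(s)x_{ij}(t)=x_{ij}(s+t)$, and $w_{ij}(u)x_{ij}(t)w_{ij}(-u)=x_{ji}(-u^{-2}t)$ for $u\in A^\times$, where $w_{ij}(u)=x_{ij}(u)x_{ji}(-u^{-1})x_{ij}(u)$. $\phi:St(2,A)\to SL_2(A)$, $x_{ij}(t)\mapsto E_{ij}(t)$ (elementary matrix), and $K_2(2,A)=\ker\phi$. $h_{12}(u)=w_{12}(u)w_{12}(-1)$, $c(u,v)=h_{12}(u)h_{12}(v)h_{12}(uv)^{-1}\in K_2(2,A)$. For a field $F$ with at least four elements $SL_2(F)$ is perfect and $St(2,F)\to SL_2(F)$ is a central extension; $\bar f$ is induced by $[X|Y]\mapsto s(X)s(Y)s(XY)^{-1}$ for any set-theoretic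 section $s$ of $\phi$ (independent of $s$). Matrices in $SL_2(A)$: $E_{12}(x)=\begin{pmatrix}1&x\\ 0&1\end{pmatrix}$, $D(u)=\begin{pmatrix}u&0\\ 0&u^{-1}\end{pmatrix}$, $w=\begin{pmatrix}0&1\\ -1&0\end{pmatrix}$, $G_a=\begin{pmatrix}0&-1\\ 1&a+a^{-1}\end{pmatrix}$, $H_a=\begin{pmatrix}1&0\\ a&1\end{pmatrix}$, $R_a=\begin{pmatrix}a&-1\\ 0&a^{-1}\end{pmatrix}$ ($a\in A^\times$), and, when $a,a^2-1\in A^\times$, $\tilde H_a=\begin{pmatrix}\frac1{1-a}&\frac a{1-a}\\ \frac a{1+a}&\frac1{1+a}\end{pmatrix}$. Chains in $\bar F_2(SL_2(A))$: $\Theta_a=[H_a|G_a]-[R_a|H_a]+[w^{-1}|wG_a]$; $\tilde\Theta_a=[\tilde H_a|G_a]-[D(a)|\tilde H_a]+[w^{-1}|wG_a]$; and for $\lambda\in A^\times$ with $\lambda^2-1\in A^\times$, $x\in A$, $x'=x/(\lambda^2-1)$: $\Psi_x=\Psi_{x,\lambda}=[E_{12}(x)|E_{12}(x')D(\lambda)]-[D(\lambda)|E_{12}(x')]+[E_{12}(x')|D(\lambda)]$. $C(a,b)_\lambda\in H_2(SL_2(A),\mathbb{Z})$ is the class of the cycle $$F(a,b)_\lambda=[R_a|R_b]+[R_aR_b|(R_aR_b)^{-1}R_{ab}]+\Theta_a+\Theta_b-\Theta_{ab}-\Theta_1+\Psi_{ab+(ab)^{-1}}-\Psi_{a+a^{-1}}-\Psi_{b+b^{-1}}+\Psi_2-\Psi_{-1}-\Psi_{(ab)^{-1}(a+b^{-1}-1)}.$$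 When $a^2-1,b^2-1,(ab)^2-1\in A^\times$, $\tilde C(a,b)_\lambda$ is the class of the cycle $$\tilde F(a,b)_\lambda=[D(a)|D(b)]+\tilde\Theta_a+\tilde\Theta_b-\tilde\Theta_{ab}-\Theta_1+\Psi_{ab+(ab)^{-1}}-\Psi_{a+a^{-1}}-\Psi_{b+b^{-1}}+\Psi_2-\Psi_{-1}.$$ *)

theory Defs
  imports "HOL-Analysis.Determinants" "HOL-Algebra.Free_Abelian_Groups"
begin

section \<open>Homology of a group via the inhomogeneous bar complex\<close>

text \<open>
  The symbol \<open>[g_n|...|g_1]\<close> is the list \<open>[g_n, ..., g_1]\<close>; symbols containing the
  neutral element are not set to zero (the complex is not normalised).
\<close>

definition bar_chain_group :: "('g, 'm) monoid_scheme \<Rightarrow> nat \<Rightarrow> ('g list \<Rightarrow>\<^sub>0 int) monoid" where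
  "bar_chain_group G n = free_Abelian_group {gs. length gs = n \<and> set gs \<subseteq> carrier G}"

definition bar_face :: "('g, 'm) monoid_scheme \<Rightarrow> nat \<Rightarrow> 'g list \<Rightarrow> 'g list" where
  "bar_face G i gs =
     (if i = 0 then tl gs
      else if i = length gs then butlast gs
      else take (i - 1) gs @ [gs ! (i - 1) \<otimes>\<^bsub>G\<^esub> gs ! i] @ drop (Suc i) gs)"

definition bar_boundary ::
  "('g, 'm) monoid_scheme \<Rightarrow> nat \<Rightarrow> ('g list \<Rightarrow>\<^sub>0 int) \<Rightarrow> ('g list \<Rightarrow>\<^sub>0 int)" where
  "bar_boundary G n =
     (if n = 0 then (\<lambda>_. 0)
      else frag_extend (\<lambda>gs. \<Sum>i\<le>n. frag_cmul ((- 1) ^ i) (frag_of (bar_face G i gs))))"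

lemma bar_boundary_2:
  "bar_boundary G 2 (frag_of [g, h]) = frag_of [g] + frag_of [h] - frag_of [g \<otimes>\<^bsub>G\<^esub> h]"
  by (simp add: bar_boundary_def bar_face_def numeral_2_eq_2 algebra_simps)

definition bar_cycle_group :: "('g, 'm) monoid_scheme \<Rightarrow> nat \<Rightarrow> ('g list \<Rightarrow>\<^sub>0 int) monoid" where
  "bar_cycle_group G n =
     subgroup_generated (bar_chain_group G n)
       (kernel (bar_chain_group G n) (bar_chain_group G (n - 1)) (bar_boundary G n))"

definition bar_boundaries :: "('g, 'm) monoid_scheme \<Rightarrow> nat \<Rightarrow> ('g list \<Rightarrow>\<^sub>0 int) set" where
  "bar_boundaries G n = bar_boundary G (Suc n) ` carrier (bar_chain_group G (Suc n))"

definition group_homology ::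
  "nat \<Rightarrow> ('g, 'm) monoid_scheme \<Rightarrow> ('g list \<Rightarrow>\<^sub>0 int) set monoid" where
  "group_homology n G = bar_cycle_group G n Mod bar_boundaries G n"

definition homology_class ::
  "nat \<Rightarrow> ('g, 'm) monoid_scheme \<Rightarrow> ('g list \<Rightarrow>\<^sub>0 int) \<Rightarrow> ('g list \<Rightarrow>\<^sub>0 int) set" where
  "homology_class n G z = bar_boundaries G n #>\<^bsub>bar_cycle_group G n\<^esub> z"


section \<open>Groups given by generators and relations\<close>

text \<open>
  A word is a list of letters \<open>(g, e)\<close>, which stands for the generator \<open>g\<close> if \<open>e\<close> is true
  and for its inverse otherwise.  A pair \<open>(u, v)\<close> in \<open>R\<close> is the relation \<open>u = v\<close>.
\<close>

type_synonym 'g word = "('g \<times> bool) list"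

inductive pres_eq :: "('g word \<times> 'g word) set \<Rightarrow> 'g word \<Rightarrow> 'g word \<Rightarrow> bool"
  for R :: "('g word \<times> 'g word) set" where
  refl: "pres_eq R u u"
| sym: "pres_eq R u v \<Longrightarrow> pres_eq R v u"
| trans: "pres_eq R u v \<Longrightarrow> pres_eq R v w \<Longrightarrow> pres_eq R u w"
| append: "pres_eq R u u' \<Longrightarrow> pres_eq R v v' \<Longrightarrow> pres_eq R (u @ v) (u' @ v')"
| cancel: "pres_eq R [(g, e), (g, \<not> e)] []"
| rel: "(u, v) \<in> R \<Longrightarrow> pres_eq R u v"

definition pres_class :: "('g word \<times> 'g word) set \<Rightarrow> 'g word \<Rightarrow> 'g word set" where
  "pres_class R u = {v. pres_eq R u v}"

definition presented_group :: "('g word \<times> 'g word) set \<Rightarrow> 'g word set monoid" where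
  "presented_group R =
     \<lparr>carrier = range (pres_class R),
      monoid.mult = (\<lambda>X Y. \<Union>u\<in>X. \<Union>v\<in>Y. pres_class R (u @ v)),
      one = pres_class R []\<rparr>"

definition word_eval :: "('h, 'm) monoid_scheme \<Rightarrow> ('g \<Rightarrow> 'h) \<Rightarrow> 'g word \<Rightarrow> 'h" where
  "word_eval H f w =
     foldr (\<lambda>(g, e) y. (if e then f g else inv\<^bsub>H\<^esub> f g) \<otimes>\<^bsub>H\<^esub> y) w \<one>\<^bsub>H\<^esub>"

text \<open>The map out of a presented group that sends each generator \<open>g\<close> to \<open>f g\<close>.\<close>

definition pres_map :: "('h, 'm) monoid_scheme \<Rightarrow> ('g \<Rightarrow> 'h) \<Rightarrow> 'g word set \<Rightarrow> 'h" where
  "pres_map H f X = the_elem (word_eval H f ` X)"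


section \<open>The groups $SL_2(F)$, $St(2,F)$ and $K_2(2,F)$\<close>

definition SL2 :: "('a::field ^ 2 ^ 2) monoid" where
  "SL2 = \<lparr>carrier = {A. det A = 1}, monoid.mult = (**), one = mat 1\<rparr>"

definition mat2 :: "'a::field \<Rightarrow> 'a \<Rightarrow> 'a \<Rightarrow> 'a \<Rightarrow> 'a ^ 2 ^ 2" where
  "mat2 p q r s = vector [vector [p, q], vector [r, s]]"

datatype root = R12 | R21

fun opp :: "root \<Rightarrow> root" where
  "opp R12 = R21"
| "opp R21 = R12"

text \<open>
  The generator \<open>x_ij(t)\<close> is the pair of the root \<open>ij\<close> and \<open>t\<close>, and \<open>opp\<close> exchanges
  \<open>ij\<close> and \<open>ji\<close>.
\<close>

definition x_word :: "root \<Rightarrow> 'a::field \<Rightarrow> (root \<times> 'a) word" where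
  "x_word r t = [((r, t), True)]"

definition w_word :: "root \<Rightarrow> 'a::field \<Rightarrow> (root \<times> 'a) word" where
  "w_word r u = x_word r u @ x_word (opp r) (- inverse u) @ x_word r u"

definition steinberg_rels :: "((root \<times> 'a::field) word \<times> (root \<times> 'a) word) set" where
  "steinberg_rels =
     {(x_word r s @ x_word r t, x_word r (s + t)) | r s t. True} \<union>
     {(w_word r u @ x_word r t @ w_word r (- u), x_word (opp r) (- (inverse u)\<^sup>2 * t)) | r u t.
        u \<noteq> 0}"

definition St2 :: "(root \<times> 'a::field) word set monoid" where
  "St2 = presented_group steinberg_rels"

fun elem_mat :: "root \<times> 'a::field \<Rightarrow> 'a ^ 2 ^ 2" where
  "elem_mat (R12, t) = mat2 1 t 0 1"
| "elem_mat (R21, t) = mat2 1 0 t 1"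

definition St2_to_SL2 :: "(root \<times> 'a::field) word set \<Rightarrow> 'a ^ 2 ^ 2" where
  "St2_to_SL2 = pres_map SL2 elem_mat"

definition K2_2 :: "(root \<times> 'a::field) word set monoid" where
  "K2_2 = St2\<lparr>carrier := kernel St2 SL2 St2_to_SL2\<rparr>"

definition St_w12 :: "'a::field \<Rightarrow> (root \<times> 'a) word set" where
  "St_w12 u = pres_class steinberg_rels (w_word R12 u)"

definition St_h12 :: "'a::field \<Rightarrow> (root \<times> 'a) word set" where
  "St_h12 u = St_w12 u \<otimes>\<^bsub>St2\<^esub> St_w12 (- 1)"

definition St_c :: "'a::field \<Rightarrow> 'a \<Rightarrow> (root \<times> 'a) word set" where
  "St_c u v = St_h12 u \<otimes>\<^bsub>St2\<^esub> St_h12 v \<otimes>\<^bsub>St2\<^esub> inv\<^bsub>St2\<^esub> (St_h12 (u * v))"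


section \<open>The homomorphism $H_2(SL_2(F),Z) \to K_2(2,F)$\<close>

definition is_section :: "('a::field ^ 2 ^ 2 \<Rightarrow> (root \<times> 'a) word set) \<Rightarrow> bool" where
  "is_section s \<longleftrightarrow> (\<forall>X \<in> carrier SL2. s X \<in> carrier St2 \<and> St2_to_SL2 (s X) = X)"

definition section_cocycle ::
  "('a::field ^ 2 ^ 2 \<Rightarrow> (root \<times> 'a) word set) \<Rightarrow> ('a ^ 2 ^ 2) list \<Rightarrow> (root \<times> 'a) word set" where
  "section_cocycle s p =
     s (p ! 0) \<otimes>\<^bsub>St2\<^esub> s (p ! 1) \<otimes>\<^bsub>St2\<^esub> inv\<^bsub>St2\<^esub> (s (p ! 0 \<otimes>\<^bsub>SL2\<^esub> p ! 1))"

text \<open>The extension of \<open>[X|Y] \<mapsto> s(X) s(Y) s(XY)\<^sup>-\<^sup>1\<close> to 2-chains, with values in \<open>K2_2\<close>.\<close>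

definition cocycle_eval ::
  "('a::field ^ 2 ^ 2 \<Rightarrow> (root \<times> 'a) word set) \<Rightarrow> (('a ^ 2 ^ 2) list \<Rightarrow>\<^sub>0 int) \<Rightarrow> (root \<times> 'a) word set"
  where
  "cocycle_eval s z =
     finprod K2_2 (\<lambda>p. section_cocycle s p [^]\<^bsub>K2_2\<^esub> Poly_Mapping.lookup z p) (Poly_Mapping.keys z)"

text \<open>
  The map induced on homology classes.  The value is specified only if \<open>cocycle_eval s\<close> is
  constant on the class, that is, if the map is well defined there.
\<close>

definition H2_to_K2 ::
  "('a::field ^ 2 ^ 2 \<Rightarrow> (root \<times> 'a) word set) \<Rightarrow> (('a ^ 2 ^ 2) list \<Rightarrow>\<^sub>0 int) set \<Rightarrow> (root \<times> 'a) word set"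
  where
  "H2_to_K2 s Z = the_elem (cocycle_eval s ` Z)"


section \<open>The cycles $F(a,b)_\lambda$ and $\tilde F(a,b)_\lambda$\<close>

definition E12 :: "'a::field \<Rightarrow> 'a ^ 2 ^ 2" where "E12 x = mat2 1 x 0 1"
definition Dm :: "'a::field \<Rightarrow> 'a ^ 2 ^ 2" where "Dm u = mat2 u 0 0 (inverse u)"
definition wm :: "'a::field ^ 2 ^ 2" where "wm = mat2 0 1 (- 1) 0"
definition Gm :: "'a::field \<Rightarrow> 'a ^ 2 ^ 2" where "Gm a = mat2 0 (- 1) 1 (a + inverse a)"
definition Hm :: "'a::field \<Rightarrow> 'a ^ 2 ^ 2" where "Hm a = mat2 1 0 a 1"
definition Rm :: "'a::field \<Rightarrow> 'a ^ 2 ^ 2" where "Rm a = mat2 a (- 1) 0 (inverse a)"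
definition Htm :: "'a::field \<Rightarrow> 'a ^ 2 ^ 2" where
  "Htm a = mat2 (1 / (1 - a)) (a / (1 - a)) (a / (1 + a)) (1 / (1 + a))"

abbreviation bar2 :: "'g \<Rightarrow> 'g \<Rightarrow> 'g list \<Rightarrow>\<^sub>0 int" where
  "bar2 X Y \<equiv> frag_of [X, Y]"

definition Theta :: "'a::field \<Rightarrow> ('a ^ 2 ^ 2) list \<Rightarrow>\<^sub>0 int" where
  "Theta a = bar2 (Hm a) (Gm a) - bar2 (Rm a) (Hm a) + bar2 (inv\<^bsub>SL2\<^esub> wm) (wm ** Gm a)"

definition Theta_tilde :: "'a::field \<Rightarrow> ('a ^ 2 ^ 2) list \<Rightarrow>\<^sub>0 int" where
  "Theta_tilde a = bar2 (Htm a) (Gm a) - bar2 (Dm a) (Htm a) + bar2 (inv\<^bsub>SL2\<^esub> wm) (wm ** Gm a)"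

definition Psi :: "'a::field \<Rightarrow> 'a \<Rightarrow> ('a ^ 2 ^ 2) list \<Rightarrow>\<^sub>0 int" where
  "Psi l x = (let x' = x / (l\<^sup>2 - 1) in
     bar2 (E12 x) (E12 x' ** Dm l) - bar2 (Dm l) (E12 x') + bar2 (E12 x') (Dm l))"

definition F_cycle :: "'a::field \<Rightarrow> 'a \<Rightarrow> 'a \<Rightarrow> ('a ^ 2 ^ 2) list \<Rightarrow>\<^sub>0 int" where
  "F_cycle a b l =
     bar2 (Rm a) (Rm b) + bar2 (Rm a ** Rm b) (inv\<^bsub>SL2\<^esub> (Rm a ** Rm b) ** Rm (a * b))
     + Theta a + Theta b - Theta (a * b) - Theta 1
     + Psi l (a * b + inverse (a * b)) - Psi l (a + inverse a) - Psi l (b + inverse b)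
     + Psi l 2 - Psi l (- 1) - Psi l (inverse (a * b) * (a + inverse b - 1))"

definition F_tilde_cycle :: "'a::field \<Rightarrow> 'a \<Rightarrow> 'a \<Rightarrow> ('a ^ 2 ^ 2) list \<Rightarrow>\<^sub>0 int" where
  "F_tilde_cycle a b l =
     bar2 (Dm a) (Dm b)
     + Theta_tilde a + Theta_tilde b - Theta_tilde (a * b) - Theta 1
     + Psi l (a * b + inverse (a * b)) - Psi l (a + inverse a) - Psi l (b + inverse b)
     + Psi l 2 - Psi l (- 1)"

definition C_class :: "'a::field \<Rightarrow> 'a \<Rightarrow> 'a \<Rightarrow> (('a ^ 2 ^ 2) list \<Rightarrow>\<^sub>0 int) set" where
  "C_class a b l = homology_class 2 SL2 (F_cycle a b l)"

definition C_tilde_class :: "'a::field \<Rightarrow> 'a \<Rightarrow> 'a \<Rightarrow> (('a ^ 2 ^ 2) list \<Rightarrow>\<^sub>0 int) set" where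
  "C_tilde_class a b l = homology_class 2 SL2 (F_tilde_cycle a b l)"


section \<open>Consistency of the definitions\<close>

text \<open>
  \<open>SL2\<close> and presented groups are groups, the projection from \<open>St2\<close> is well defined and has
  sections, and the two chains above are cycles.
\<close>


lemma mat2_mult: "mat2 p q r s ** mat2 p' q' r' s' =
   mat2 (p * p' + q * r') (p * q' + q * s') (r * p' + s * r') (r * q' + s * s')"
  by (simp add: mat2_def matrix_matrix_mult_def vec_eq_iff forall_2 sum_2)

lemma mat2_one: "mat 1 = mat2 1 0 0 1"
  by (simp add: mat2_def mat_def vec_eq_iff forall_2)

lemma det_mat2: "det (mat2 p q r s) = p * s - q * r"
  by (simp add: mat2_def det_2)

lemma mat2_cases: obtains p q r s where "A = mat2 p q r s"
proof -
  have "A = mat2 (A$1$1) (A$1$2) (A$2$1) (A$2$2)"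
    by (simp add: mat2_def vec_eq_iff forall_2)
  then show ?thesis using that by blast
qed

lemma group_SL2: "group SL2"
proof (rule groupI)
  fix X assume "X \<in> carrier SL2"
  then obtain p q r s where X: "X = mat2 p q r s" "p * s - q * r = 1"
    by (metis (mono_tags) SL2_def det_mat2 mat2_cases mem_Collect_eq partial_object.simps(1))
  then show "\<exists>Y\<in>carrier SL2. Y \<otimes>\<^bsub>SL2\<^esub> X = \<one>\<^bsub>SL2\<^esub>"
    by (intro bexI[of _ "mat2 s (- q) (- r) p"])
       (auto simp: SL2_def mat2_mult mat2_one det_mat2 algebra_simps)
qed (auto simp: SL2_def det_mul matrix_mul_assoc)

lemma (in group) word_eval_closed: "range f \<subseteq> carrier G \<Longrightarrow> word_eval G f u \<in> carrier G"
  by (induction u) (auto simp: word_eval_def image_subset_iff intro!: m_closed)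

lemma (in group) word_eval_append:
  "range f \<subseteq> carrier G \<Longrightarrow> word_eval G f (u @ v) = word_eval G f u \<otimes> word_eval G f v"
proof (induction u)
  case Nil
  then show ?case using word_eval_closed[OF Nil] by (simp add: word_eval_def)
next
  case (Cons l u)
  have "range f \<subseteq> carrier G" by fact
  then have "f (fst l) \<in> carrier G" by blast
  with Cons word_eval_closed[OF Cons.prems] show ?case
    by (cases l) (simp add: word_eval_def m_assoc)
qed

lemma (in group) word_eval_pres_eq:
  assumes f: "range f \<subseteq> carrier G"
    and R: "\<And>u v. (u, v) \<in> R \<Longrightarrow> word_eval G f u = word_eval G f v"
    and "pres_eq R u v"
  shows "word_eval G f u = word_eval G f v"
  using assms(3)
proof induction
  case (cancel g e)
  have "f g \<in> carrier G" using f by blast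
  then show ?case by (cases e) (simp_all add: word_eval_def)
qed (simp_all add: R word_eval_append[OF f])

lemma (in group) pres_map_class:
  assumes f: "range f \<subseteq> carrier G"
    and R: "\<And>u v. (u, v) \<in> R \<Longrightarrow> word_eval G f u = word_eval G f v"
  shows "pres_map G f (pres_class R u) = word_eval G f u"
proof -
  have "word_eval G f v = word_eval G f u" if "v \<in> pres_class R u" for v
    using that word_eval_pres_eq[of f R u v, OF f R] by (simp add: pres_class_def)
  moreover have "u \<in> pres_class R u"
    by (simp add: pres_class_def pres_eq.refl)
  ultimately have "word_eval G f ` pres_class R u = {word_eval G f u}"
    by blast
  then show ?thesis by (simp add: pres_map_def)
qed

lemma elem_mat_SL2: "range elem_mat \<subseteq> carrier SL2"
proof -
  have "elem_mat p \<in> carrier SL2" for p :: "root \<times> 'a"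
    by (cases p rule: elem_mat.cases) (auto simp: SL2_def det_mat2)
  then show ?thesis by blast
qed

lemma elem_mat_rels:
  assumes "(u, v) \<in> steinberg_rels"
  shows "word_eval SL2 elem_mat u = word_eval SL2 elem_mat v"
proof -
  have opp: "\<And>r. r = R12 \<or> r = R21" by (metis root.exhaust)
  consider r s t where "u = x_word r s @ x_word r t" "v = x_word r (s + t)"
    | r c t where "c \<noteq> 0" "u = w_word r c @ x_word r t @ w_word r (- c)"
        "v = x_word (opp r) (- (inverse c)\<^sup>2 * t)"
    using assms unfolding steinberg_rels_def by blast
  then show ?thesis
  proof cases
    case 1 then show ?thesis using opp[of r]
      by (auto simp: word_eval_def x_word_def SL2_def mat2_one mat2_mult algebra_simps)
  next
    case 2 then show ?thesis using opp[of r]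
      by (auto simp: word_eval_def w_word_def x_word_def SL2_def mat2_one mat2_mult field_simps power2_eq_square)
  qed
qed

lemma St2_to_SL2_class:
  "St2_to_SL2 (pres_class steinberg_rels u) = word_eval SL2 elem_mat u"
  unfolding St2_to_SL2_def
  by (rule group.pres_map_class[OF group_SL2 elem_mat_SL2 elem_mat_rels])

lemma ex_section: "\<exists>s. is_section (s :: 'a::field ^ 2 ^ 2 \<Rightarrow> _)"
proof -
  have *: "\<exists>u. word_eval SL2 elem_mat u = mat2 p q r s" if "p * s - q * r = 1" "r \<noteq> 0"
    for p q r s :: 'a
    using that
    by (intro exI[of _ "x_word R12 ((p - 1) / r) @ x_word R21 r @ x_word R12 ((s - 1) / r)"])
       (auto simp: word_eval_def x_word_def SL2_def mat2_one mat2_mult field_simps)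
  have "\<exists>u. word_eval SL2 elem_mat u = X" if "X \<in> carrier SL2" for X :: "'a ^ 2 ^ 2"
  proof -
    obtain p q r s where X: "X = mat2 p q r s" by (rule mat2_cases)
    with that have d: "p * s - q * r = 1" by (simp add: SL2_def det_mat2)
    show ?thesis
    proof (cases "r = 0")
      case False
      with * d X show ?thesis by blast
    next
      case True
      with d have "p * (q + s) - q * p = 1" "p \<noteq> 0" by (auto simp: algebra_simps)
      from *[OF this] obtain u where "word_eval SL2 elem_mat u = mat2 p q p (q + s)" by blast
      then have "word_eval SL2 elem_mat (x_word R21 (- 1) @ u) = X"
        using True X
        by (simp add: x_word_def group.word_eval_append[OF group_SL2 elem_mat_SL2])
           (simp add: word_eval_def SL2_def mat2_one mat2_mult)
      then show ?thesis by blast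
    qed
  qed
  then obtain u where "\<And>X :: 'a ^ 2 ^ 2. X \<in> carrier SL2 \<Longrightarrow> word_eval SL2 elem_mat (u X) = X"
    by metis
  then have "is_section (\<lambda>X. pres_class steinberg_rels (u X))"
    by (simp add: is_section_def St2_to_SL2_class St2_def presented_group_def)
  then show ?thesis by blast
qed

lemma pres_class_eq: "pres_class R u = pres_class R v \<longleftrightarrow> pres_eq R u v"
  unfolding pres_class_def using pres_eq.refl pres_eq.sym pres_eq.trans by blast

lemma pres_mult:
  "pres_class R u \<otimes>\<^bsub>presented_group R\<^esub> pres_class R v = pres_class R (u @ v)"
proof -
  have "pres_class R (u' @ v') = pres_class R (u @ v)"
    if "u' \<in> pres_class R u" "v' \<in> pres_class R v" for u' v'
    unfolding pres_class_eq
    by (rule pres_eq.append; rule pres_eq.sym) (use that in \<open>simp_all add: pres_class_def\<close>)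
  then have "(\<Union>u'\<in>pres_class R u. \<Union>v'\<in>pres_class R v. pres_class R (u' @ v'))
      = (\<Union>u'\<in>pres_class R u. \<Union>v'\<in>pres_class R v. pres_class R (u @ v))"
    by (intro SUP_cong HOL.refl)
  also have "\<dots> = pres_class R (u @ v)"
    using pres_eq.refl[of R u] pres_eq.refl[of R v] by (auto simp: pres_class_def)
  finally show ?thesis by (simp add: presented_group_def)
qed

lemma group_presented_group: "group (presented_group R)"
proof (rule groupI)
  fix X assume "X \<in> carrier (presented_group R)"
  then obtain u where X: "X = pres_class R u" by (auto simp: presented_group_def)
  have "\<exists>v. pres_eq R (v @ u) []"
  proof (induction u)
    case Nil show ?case by (metis append_Nil pres_eq.refl)
  next
    case (Cons l u)
    then obtain v where v: "pres_eq R (v @ u) []" by blast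
    obtain g e where l: "l = (g, e)" by (cases l)
    have "pres_eq R ([(g, \<not> e), (g, e)] @ u) ([] @ u)"
      using pres_eq.append[OF pres_eq.cancel[of R g "\<not> e"] pres_eq.refl[of R u]] by simp
    then have "pres_eq R (v @ [(g, \<not> e), (g, e)] @ u) (v @ u)"
      using pres_eq.append[OF pres_eq.refl[of R v]] by simp
    then have "pres_eq R ((v @ [(g, \<not> e)]) @ l # u) []"
      using v l pres_eq.trans by simp blast
    then show ?case by blast
  qed
  then show "\<exists>Y\<in>carrier (presented_group R). Y \<otimes>\<^bsub>presented_group R\<^esub> X = \<one>\<^bsub>presented_group R\<^esub>"
    unfolding X by (metis (no_types, lifting) pres_class_eq pres_mult presented_group_def rangeI
        partial_object.simps(1) monoid.simps(2))
next
  show "\<And>x y. x \<in> carrier (presented_group R) \<Longrightarrow> y \<in> carrier (presented_group R) \<Longrightarrow> x \<otimes>\<^bsub>presented_group R\<^esub> y \<in> carrier (presented_group R)"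
    using pres_mult[of R] by (force simp: presented_group_def)
  have one: "\<one>\<^bsub>presented_group R\<^esub> = pres_class R []" by (simp add: presented_group_def)
  then show "\<one>\<^bsub>presented_group R\<^esub> \<in> carrier (presented_group R)" by (simp add: presented_group_def)
  have c: "carrier (presented_group R) = range (pres_class R)" by (simp add: presented_group_def)
  show "\<one>\<^bsub>presented_group R\<^esub> \<otimes>\<^bsub>presented_group R\<^esub> x = x" if "x \<in> carrier (presented_group R)" for x
    using that unfolding c one by (auto simp: pres_mult)
  show "x \<otimes>\<^bsub>presented_group R\<^esub> y \<otimes>\<^bsub>presented_group R\<^esub> z = x \<otimes>\<^bsub>presented_group R\<^esub> (y \<otimes>\<^bsub>presented_group R\<^esub> z)"
    if "x \<in> carrier (presented_group R)" "y \<in> carrier (presented_group R)" "z \<in> carrier (presented_group R)" for x y z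
    using that unfolding c by (auto simp: pres_mult)
qed

lemma mat2_eq: "mat2 p q r s = mat2 p' q' r' s' \<longleftrightarrow> p = p' \<and> q = q' \<and> r = r' \<and> s = s'"
  by (auto simp: mat2_def vec_eq_iff forall_2)

lemma inv_SL2: "p * s - q * r = 1 \<Longrightarrow> inv\<^bsub>SL2\<^esub> (mat2 p q r s) = mat2 s (- q) (- r) p"
  by (rule group.inv_equality[OF group_SL2])
    (auto simp: SL2_def mat2_mult mat2_one det_mat2 algebra_simps)

lemma bar_boundary_2_add_diff: "bar_boundary G 2 (x + y) = bar_boundary G 2 x + bar_boundary G 2 y"
  "bar_boundary G 2 (x - y) = bar_boundary G 2 x - bar_boundary G 2 y"
  by (simp_all add: bar_boundary_def frag_extend_add frag_extend_diff)

lemmas SL2_mat_defs = Hm_def Gm_def Rm_def Htm_def Dm_def wm_def E12_def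

lemma mult_SL2: "X \<otimes>\<^bsub>SL2\<^esub> Y = X ** Y" by (simp add: SL2_def)

lemma boundary_Theta: "a \<noteq> 0 \<Longrightarrow> bar_boundary SL2 2 (Theta a) = frag_of [inv\<^bsub>SL2\<^esub> wm] + frag_of [E12 (a + inverse a)] - frag_of [Rm a]"
proof -
  assume a: "a \<noteq> 0"
  have "Hm a ** Gm a = Rm a ** Hm a" "wm ** Gm a = E12 (a + inverse a)" "inv\<^bsub>SL2\<^esub> wm ** E12 (a + inverse a) = Gm a"
    using a by (simp_all add: SL2_mat_defs mat2_mult mat2_eq inv_SL2 field_simps)
  then show ?thesis by (simp add: Theta_def bar_boundary_2_add_diff bar_boundary_2 mult_SL2)
qed

lemma boundary_Theta_tilde: "a \<noteq> 0 \<Longrightarrow> a \<noteq> 1 \<Longrightarrow> a \<noteq> - 1 \<Longrightarrow> bar_boundary SL2 2 (Theta_tilde a) = frag_of [inv\<^bsub>SL2\<^esub> wm] + frag_of [E12 (a + inverse a)] - frag_of [Dm a]"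
proof -
  assume a: "a \<noteq> 0" "a \<noteq> 1" "a \<noteq> - 1"
  then have n: "1 - a \<noteq> 0" "1 + a \<noteq> 0" by (auto simp: add_eq_0_iff)
  have "Htm a ** Gm a = Dm a ** Htm a" "wm ** Gm a = E12 (a + inverse a)" "inv\<^bsub>SL2\<^esub> wm ** E12 (a + inverse a) = Gm a"
    using a n by (simp_all add: SL2_mat_defs mat2_mult mat2_eq inv_SL2 divide_simps)
  then show ?thesis by (simp add: Theta_tilde_def bar_boundary_2_add_diff bar_boundary_2 mult_SL2)
qed

lemma boundary_Psi: "l \<noteq> 0 \<Longrightarrow> l \<noteq> 1 \<Longrightarrow> l \<noteq> - 1 \<Longrightarrow> bar_boundary SL2 2 (Psi l x) = frag_of [E12 x]"
proof -
  assume l: "l \<noteq> 0" "l \<noteq> 1" "l \<noteq> - 1"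
  then have n: "l\<^sup>2 - 1 \<noteq> 0" by (simp add: power2_eq_1_iff)
  define y where "y = x / (l\<^sup>2 - 1)"
  with n have x: "x = y * (l\<^sup>2 - 1)" by simp
  have "E12 x ** (E12 y ** Dm l) = Dm l ** E12 y"
    unfolding x using l  by (simp add: SL2_mat_defs mat2_mult mat2_eq  field_simps power2_eq_square)
  then show ?thesis unfolding Psi_def Let_def y_def[symmetric] by (simp add: bar_boundary_2_add_diff bar_boundary_2 mult_SL2)
qed

lemma F_cycle_cycle:
  assumes "a \<noteq> 0" "b \<noteq> 0" "l \<noteq> 0" "l \<noteq> 1" "l \<noteq> - 1"
  shows "bar_boundary SL2 2 (F_cycle a b l) = 0"
proof -
  have e: "inv\<^bsub>SL2\<^esub> (Rm a ** Rm b) ** Rm (a * b) = E12 (inverse (a * b) * (a + inverse b - 1))"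
    "Rm a ** Rm b ** E12 (inverse (a * b) * (a + inverse b - 1)) = Rm (a * b)"
    "Rm 1 = E12 (- 1 :: 'a)"
    using assms by (simp_all add: SL2_mat_defs mat2_mult inv_SL2 mat2_eq field_simps)
  show ?thesis using assms
    unfolding F_cycle_def e
    by (simp add: bar_boundary_2_add_diff bar_boundary_2 mult_SL2 boundary_Theta boundary_Psi e del: inverse_mult_distrib)
qed

lemma F_tilde_cycle_cycle:
  assumes "a \<noteq> 0" "b \<noteq> 0" "l \<noteq> 0" "l \<noteq> 1" "l \<noteq> - 1" "a \<notin> {1, - 1}" "b \<notin> {1, - 1}" "a * b \<notin> {1, - 1}"
  shows "bar_boundary SL2 2 (F_tilde_cycle a b l) = 0"
proof -
  have e: "Dm a ** Dm b = Dm (a * b)" "Rm 1 = E12 (- 1 :: 'a)"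
    using assms by (simp_all add: SL2_mat_defs mat2_mult inv_SL2 mat2_eq field_simps)
  show ?thesis using assms
    unfolding F_tilde_cycle_def
    by (simp add: bar_boundary_2_add_diff bar_boundary_2 mult_SL2 boundary_Theta boundary_Theta_tilde boundary_Psi e del: inverse_mult_distrib)
qed

end

theory Submission
  imports Defs
begin

text \<open>
  Write \<open>\<phi>\<close> for the projection of the Steinberg group, \<open>x, y\<close> for its two root subgroups and
  \<open>h(u) = w(u) w(-1)\<close>.  By the Bruhat decomposition an element of \<open>ker \<phi>\<close> is a product of \<open>w(u)\<close>'s
  that acts trivially on \<open>x\<close> and \<open>y\<close>, so \<open>ker \<phi>\<close> is central.  With \<open>d(g) = s(\<phi> g) g\<^sup>-\<^sup>1\<close> the cocycle
  satisfies \<open>f(\<phi> g, \<phi> g') = d(g) d(g') d(g g')\<^sup>-\<^sup>1\<close>; hence the value of \<open>f\<close> on a chain is \<open>d\<close> of the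
  boundary of any lift of that chain to \<open>St(2,F)\<close>.

  Since \<open>h(\<lambda>) x(t') = x(\<lambda>\<^sup>2 t') h(\<lambda>)\<close>, the chain \<open>\<Psi>\<^sub>t\<close> lifts to one with boundary \<open>[x(t)]\<close>, and
  \<open>\<Theta>\<^sub>a\<close> lifts to one with boundary \<open>[w(-1)] + [x(a + a\<^sup>-\<^sup>1)] - [r\<^sub>a]\<close>, where
  \<open>r\<^sub>a = y(a) w(-1) x(a + a\<^sup>-\<^sup>1) y(-a) = x(-a) h(a)\<close>.  Everything in \<open>F(a,b)\<close> cancels except
  \<open>[r\<^sub>a\<^sub>b] - [r\<^sub>a r\<^sub>b x(t)]\<close>, and \<open>r\<^sub>a r\<^sub>b x(t) = c(a,b) r\<^sub>a\<^sub>b\<close>.  For the second cycle the lift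
  \<open>h(1+a) x(a/(1-a\<^sup>2)) y(a)\<close> of the conjugating matrix leads to \<open>h(a)\<close> in place of \<open>r\<^sub>a\<close>, because
  \<open>h(1+a)\<close> commutes with \<open>h(a)\<close> by the Steinberg relation \<open>c(u,1-u) = 1\<close>.
\<close>

section \<open>Steinberg groups of rank one\<close>

lemma (in group) inv_cancel_left:
  assumes "g \<in> carrier G" "g' \<in> carrier G"
  shows "g \<otimes> (inv g \<otimes> g') = g'" "inv g \<otimes> (g \<otimes> g') = g'"
  using assms by (simp_all flip: m_assoc)

locale steinberg_group = group G for G (structure) +
  fixes x y :: "'b::field \<Rightarrow> 'a"
  assumes x_closed [simp]: "x t \<in> carrier G"
    and y_closed [simp]: "y t \<in> carrier G"
    and x_add: "x s \<otimes> x t = x (s + t)"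
    and y_add: "y s \<otimes> y t = y (s + t)"
    and weyl_conj_x: "u \<noteq> 0 \<Longrightarrow>
      (x u \<otimes> y (- inverse u) \<otimes> x u) \<otimes> x t \<otimes> (x (- u) \<otimes> y (inverse u) \<otimes> x (- u)) = y (- (t / u\<^sup>2))"
begin

definition w :: "'b \<Rightarrow> 'a" where "w u = x u \<otimes> y (- inverse u) \<otimes> x u"

definition h :: "'b \<Rightarrow> 'a" where "h u = w u \<otimes> w (- 1)"

lemma w_closed [simp]: "w u \<in> carrier G"
  by (simp add: w_def)

lemma h_closed [simp]: "h u \<in> carrier G"
  by (simp add: h_def)

lemma x_zero [simp]: "x 0 = \<one>"
  using x_add[of 0 0] by simp

lemma y_zero [simp]: "y 0 = \<one>"
  using y_add[of 0 0] by simp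

lemma x_add_left: "g \<in> carrier G \<Longrightarrow> x s \<otimes> (x t \<otimes> g) = x (s + t) \<otimes> g"
  by (simp add: x_add flip: m_assoc)

lemma y_add_left: "g \<in> carrier G \<Longrightarrow> y s \<otimes> (y t \<otimes> g) = y (s + t) \<otimes> g"
  by (simp add: y_add flip: m_assoc)

lemmas xy_add = x_add y_add x_add_left y_add_left

lemma w_minus [simp]: "w u \<otimes> w (- u) = \<one>"
  by (simp add: w_def m_assoc xy_add)

lemma w_minus' [simp]: "w (- u) \<otimes> w u = \<one>"
  using w_minus[of "- u"] by simp

lemma w_minus_left [simp]:
  "g \<in> carrier G \<Longrightarrow> w u \<otimes> (w (- u) \<otimes> g) = g"
  "g \<in> carrier G \<Longrightarrow> w (- u) \<otimes> (w u \<otimes> g) = g"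
  by (simp_all flip: m_assoc)

lemma w_x:
  assumes "u \<noteq> 0" shows "w u \<otimes> x t = y (- (t / u\<^sup>2)) \<otimes> w u"
proof -
  have "w u \<otimes> x t \<otimes> w (- u) = y (- (t / u\<^sup>2))"
    using weyl_conj_x[OF assms, of t] by (simp add: w_def)
  then have "w u \<otimes> x t \<otimes> w (- u) \<otimes> w u = y (- (t / u\<^sup>2)) \<otimes> w u"
    by simp
  then show ?thesis by (simp add: m_assoc)
qed

lemma w_x_left:
  "u \<noteq> 0 \<Longrightarrow> g \<in> carrier G \<Longrightarrow> w u \<otimes> (x t \<otimes> g) = y (- (t / u\<^sup>2)) \<otimes> (w u \<otimes> g)"
  by (simp add: w_x flip: m_assoc)

text \<open>Since \<open>w (- u)\<close> is inverse to \<open>w u\<close>, this is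
  \<open>w_x\<close> for \<open>- u\<close> read from right to left.\<close>

lemma w_y:
  assumes "u \<noteq> 0" shows "w u \<otimes> y t = x (- (t * u\<^sup>2)) \<otimes> w u"
proof -
  have "w u \<otimes> (w (- u) \<otimes> x (- (t * u\<^sup>2))) \<otimes> w u = w u \<otimes> (y t \<otimes> w (- u)) \<otimes> w u"
    using assms by (simp add: w_x)
  then show ?thesis by (simp add: m_assoc)
qed

lemma w_y_left:
  "u \<noteq> 0 \<Longrightarrow> g \<in> carrier G \<Longrightarrow> w u \<otimes> (y t \<otimes> g) = x (- (t * u\<^sup>2)) \<otimes> (w u \<otimes> g)"
  by (simp add: w_y flip: m_assoc)

text \<open>\<open>w u\<close> is fixed under conjugation by itself, and that conjugation exchanges
  the two root subgroups in the product \<open>x y x\<close> defining it.\<close>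

lemma w_eq_yxy:
  assumes "u \<noteq> 0" shows "w u = y (- inverse u) \<otimes> x u \<otimes> y (- inverse u)"
proof -
  have "w u = w u \<otimes> (x u \<otimes> y (- inverse u) \<otimes> x u) \<otimes> w (- u)"
    by (simp add: m_assoc flip: w_def)
  also have "\<dots> = y (- inverse u) \<otimes> x u \<otimes> y (- inverse u)"
    using assms by (simp add: m_assoc w_x w_y w_x_left w_y_left power2_eq_square field_simps)
  finally show ?thesis .
qed

text \<open>Solves the definition of \<open>w\<close> for its middle factor; with \<open>t\<close>
  nonzero every \<open>y t\<close> can thus be traded for a Weyl element between two factors
  \<open>x\<close>.\<close>

lemma y_eq_xwx: "t \<noteq> 0 \<Longrightarrow> y t = x (inverse t) \<otimes> (w (- inverse t) \<otimes> x (inverse t))"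
  by (simp add: w_def m_assoc xy_add)

lemma h_x: "u \<noteq> 0 \<Longrightarrow> h u \<otimes> x t = x (u\<^sup>2 * t) \<otimes> h u"
  by (simp add: h_def m_assoc w_x w_y_left mult.commute)

lemma h_x_left: "u \<noteq> 0 \<Longrightarrow> g \<in> carrier G \<Longrightarrow> h u \<otimes> (x t \<otimes> g) = x (u\<^sup>2 * t) \<otimes> (h u \<otimes> g)"
  by (simp add: h_x flip: m_assoc)

lemma h_one [simp]: "h 1 = \<one>"
  by (simp add: h_def)

section \<open>The Steinberg relation for u + v = 1\<close>

lemma y_conj_x:
  assumes "u \<noteq> 0"
  shows "y (inverse u) \<otimes> x (u\<^sup>2) \<otimes> y (- inverse u) = x u \<otimes> y (- 1) \<otimes> x (- u)"
    and "y (- inverse u) \<otimes> x (u\<^sup>2) \<otimes> y (inverse u) = x (- u) \<otimes> y (- 1) \<otimes> x u"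
proof -
  have *: "y (inverse v) \<otimes> x (v\<^sup>2) \<otimes> y (- inverse v) = x v \<otimes> y (- 1) \<otimes> x (- v)" if "v \<noteq> 0" for v
  proof -
    \<comment> \<open>After this substitution the inner factors \<open>x\<close> commute past
      \<open>x (v\<^sup>2)\<close> and cancel, and \<open>w (- v)\<close> carries
      \<open>x (v\<^sup>2)\<close> to \<open>y (- 1)\<close>.\<close>
    have "y (inverse v) = x v \<otimes> w (- v) \<otimes> x v" "y (- inverse v) = x (- v) \<otimes> w v \<otimes> x (- v)"
      using that y_eq_xwx[of "inverse v"] y_eq_xwx[of "- inverse v"] by (simp_all add: m_assoc)
    then show ?thesis
      using that by (simp add: m_assoc xy_add w_x_left)
  qed
  show "y (inverse u) \<otimes> x (u\<^sup>2) \<otimes> y (- inverse u) = x u \<otimes> y (- 1) \<otimes> x (- u)"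
    using *[OF assms] .
  show "y (- inverse u) \<otimes> x (u\<^sup>2) \<otimes> y (inverse u) = x (- u) \<otimes> y (- 1) \<otimes> x u"
    using *[of "- u"] assms by simp
qed

lemma steinberg_relation:
  assumes "u \<noteq> 0" "v \<noteq> 0" "u + v = 1"
  shows "h u \<otimes> h v = h (u * v)"
proof -
  have v: "v = 1 - u" using assms by (simp add: algebra_simps)
  have sq: "u - u * v = u\<^sup>2" "v - u * v = v\<^sup>2" "inverse u + inverse v = inverse (u * v)"
    using assms by (simp_all add: v power2_eq_square field_simps)
  \<comment> \<open>The outer factors are chosen so that, by u + v = 1, the exponents at the two
    ends become the squares \<open>u\<^sup>2\<close> and \<open>v\<^sup>2\<close> to which
    \<open>y_conj_x\<close> applies.\<close>
  have "x (- (u * v)) \<otimes> (w u \<otimes> w (- 1) \<otimes> w v) \<otimes> x (- (u * v))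
     = x (u - u * v) \<otimes> y (- inverse u) \<otimes> x u \<otimes> w (- 1) \<otimes> x v \<otimes> y (- inverse v) \<otimes> x (v - u * v)"
    by (simp add: w_def[of u] w_def[of v] m_assoc xy_add add.commute)
  also have "\<dots> = y (- inverse u) \<otimes> ((y (inverse u) \<otimes> x (u\<^sup>2) \<otimes> y (- inverse u)) \<otimes> x u \<otimes> w (- 1) \<otimes> x v
      \<otimes> (y (- inverse v) \<otimes> x (v\<^sup>2) \<otimes> y (inverse v))) \<otimes> y (- inverse v)"
    by (simp add: sq m_assoc xy_add)
  also have "\<dots> = y (- inverse u) \<otimes> (x u \<otimes> (y (- 1) \<otimes> w (- 1) \<otimes> y (- 1)) \<otimes> x v) \<otimes> y (- inverse v)"
    by (simp only: y_conj_x[OF assms(1)] y_conj_x[OF assms(2)]) (simp add: m_assoc xy_add)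
  \<comment> \<open>By \<open>w_eq_yxy\<close> the two factors \<open>y (- 1)\<close> strip
    \<open>w (- 1)\<close> down to \<open>x (- 1)\<close>; then u + v = 1 kills all of the middle,
    and only a product of two factors \<open>y\<close> is left.\<close>
  also have "y (- 1) \<otimes> w (- 1) \<otimes> y (- 1) = x (- 1)"
    by (simp add: w_eq_yxy[of "- 1"] m_assoc xy_add)
  also have "y (- inverse u) \<otimes> (x u \<otimes> x (- 1) \<otimes> x v) \<otimes> y (- inverse v) = y (- (inverse u + inverse v))"
    by (simp add: m_assoc xy_add v)
  also have "\<dots> = y (- inverse (u * v))"
    by (simp only: sq(3))
  finally have "x (u * v) \<otimes> (x (- (u * v)) \<otimes> (w u \<otimes> w (- 1) \<otimes> w v) \<otimes> x (- (u * v))) \<otimes> x (u * v)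
     = w (u * v)"
    by (simp only: w_def)
  then have "w u \<otimes> w (- 1) \<otimes> w v = w (u * v)"
    by (simp add: m_assoc xy_add)
  then show ?thesis
    by (simp add: h_def flip: m_assoc)
qed

text \<open>This lifts the matrix identity \<open>Hm a ** Gm a = Rm a ** Hm a\<close>: the element
  \<open>w (- 1) \<otimes> x (a + inverse a)\<close> will lie over \<open>Gm a\<close> and
  \<open>x (- a) \<otimes> h a\<close> over \<open>Rm a\<close>.\<close>

lemma y_w_x_eq:
  assumes "a \<noteq> 0"
  shows "y a \<otimes> (w (- 1) \<otimes> x (a + inverse a)) = (x (- a) \<otimes> h a) \<otimes> y a"
proof -
  have "y a \<otimes> (w (- 1) \<otimes> x (a + inverse a)) = y (- inverse a) \<otimes> w (- 1)"
    by (simp add: w_x y_add_left)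
  also have "\<dots> = x (- a) \<otimes> w a \<otimes> x (- a) \<otimes> w (- 1)"
    by (simp add: w_def[of a] m_assoc xy_add)
  also have "\<dots> = (x (- a) \<otimes> h a) \<otimes> y a"
    by (simp add: h_def m_assoc w_y)
  finally show ?thesis .
qed

end

section \<open>Bruhat decomposition, centrality of the kernel and commuting torus elements\<close>

locale steinberg_group_over_SL2 = steinberg_group G x y + phi: group_hom G SL2 \<phi>
  for G (structure) and x y :: "'b::field \<Rightarrow> 'a" and \<phi> :: "'a \<Rightarrow> 'b ^ 2 ^ 2" +
  assumes phi_x: "\<phi> (x t) = mat2 1 t 0 1"
    and phi_y: "\<phi> (y t) = mat2 1 0 t 1"
    and generated [consumes 1, case_names one x y]:
      "g \<in> carrier G \<Longrightarrow> P \<one> \<Longrightarrow> (\<And>t g. g \<in> carrier G \<Longrightarrow> P g \<Longrightarrow> P (x t \<otimes> g))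
       \<Longrightarrow> (\<And>t g. g \<in> carrier G \<Longrightarrow> P g \<Longrightarrow> P (y t \<otimes> g)) \<Longrightarrow> P g"
begin

text \<open>
  Acting on the two root subgroups like the monomial matrix below \<open>n\<close> is part of the definitions,
  so that an element of the torus over the identity matrix is visibly central.
\<close>

definition torus_elem :: "'b \<Rightarrow> 'a \<Rightarrow> bool" where
  "torus_elem e n \<longleftrightarrow> e \<noteq> 0 \<and> n \<in> carrier G \<and> \<phi> n = mat2 e 0 0 (inverse e)
     \<and> (\<forall>t. n \<otimes> x t = x (e\<^sup>2 * t) \<otimes> n) \<and> (\<forall>t. n \<otimes> y t = y (t / e\<^sup>2) \<otimes> n)"

definition weyl_elem :: "'b \<Rightarrow> 'a \<Rightarrow> bool" where
  "weyl_elem e n \<longleftrightarrow> e \<noteq> 0 \<and> n \<in> carrier G \<and> \<phi> n = mat2 0 e (- inverse e) 0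
     \<and> (\<forall>t. n \<otimes> x t = y (- (t / e\<^sup>2)) \<otimes> n) \<and> (\<forall>t. n \<otimes> y t = x (- (t * e\<^sup>2)) \<otimes> n)"

lemma phi_w: "u \<noteq> 0 \<Longrightarrow> \<phi> (w u) = mat2 0 u (- inverse u) 0"
  by (simp add: w_def phi_x phi_y mult_SL2 mat2_mult)

lemma phi_h: "u \<noteq> 0 \<Longrightarrow> \<phi> (h u) = mat2 u 0 0 (inverse u)"
  by (simp add: h_def phi_w mult_SL2 mat2_mult)

lemma weyl_elem_w: "u \<noteq> 0 \<Longrightarrow> weyl_elem u (w u)"
  by (simp add: weyl_elem_def phi_w w_x w_y)

lemma weyl_times_torus:
  assumes "u \<noteq> 0" "torus_elem e n" shows "weyl_elem (u / e) (w u \<otimes> n)"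
  using assms unfolding torus_elem_def weyl_elem_def
  by (auto simp: m_assoc phi_w mult_SL2 mat2_mult w_x_left w_y_left power_divide field_simps)

lemma weyl_times_weyl:
  assumes "u \<noteq> 0" "weyl_elem e n" shows "torus_elem (- u / e) (w u \<otimes> n)"
  using assms unfolding torus_elem_def weyl_elem_def
  by (auto simp: m_assoc phi_w mult_SL2 mat2_mult w_x_left w_y_left power_divide field_simps)

lemma torus_elem_h: "u \<noteq> 0 \<Longrightarrow> torus_elem u (h u)"
  using weyl_times_weyl[OF _ weyl_elem_w, of u "- 1"] by (simp add: h_def)

text \<open>This is the form U N U, with U the root subgroup of \<open>x\<close> and N the monomial
  elements: a torus element \<open>n\<close> gives the Borel part, a Weyl element the big
  cell.\<close>

definition bruhat_form :: "'a \<Rightarrow> bool" where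
  "bruhat_form g \<longleftrightarrow> (\<exists>t n s e. (torus_elem e n \<or> weyl_elem e n) \<and> g = x t \<otimes> (n \<otimes> x s))"

lemma bruhat_formI:
  "torus_elem e n \<Longrightarrow> g = x t \<otimes> (n \<otimes> x s) \<Longrightarrow> bruhat_form g"
  "weyl_elem e n \<Longrightarrow> g = x t \<otimes> (n \<otimes> x s) \<Longrightarrow> bruhat_form g"
  unfolding bruhat_form_def by blast+

text \<open>Left multiplication by a generator preserves the form. A factor \<open>x\<close> is
  absorbed on the left; a factor \<open>y\<close> is first rewritten by \<open>y_eq_xwx\<close>,
  which leaves some \<open>x v\<close> between a Weyl element and \<open>n\<close>.\<close>

lemma bruhat:
  assumes "g \<in> carrier G"
  shows "bruhat_form g"
  using assms
proof (induction rule: generated)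
  case one
  have "torus_elem 1 \<one>" by (simp add: torus_elem_def mat2_one[symmetric] phi.hom_one) (simp add: SL2_def)
  then show ?case by (rule bruhat_formI(1)[where t = 0 and s = 0]) simp
next
  case (x t g)
  then obtain r n s e where n: "torus_elem e n \<or> weyl_elem e n" and g: "g = x r \<otimes> (n \<otimes> x s)"
    by (auto simp: bruhat_form_def)
  then have [simp]: "n \<in> carrier G" by (auto simp: torus_elem_def weyl_elem_def)
  have "x t \<otimes> g = x (t + r) \<otimes> (n \<otimes> x s)" by (simp add: g x_add_left)
  with n show ?case by (auto intro: bruhat_formI)
next
  case (y r g)
  show ?case
  proof (cases "r = 0")
    case True
    with y show ?thesis by simp
  next
    case False
    obtain t n s e where n: "torus_elem e n \<or> weyl_elem e n" and g: "g = x t \<otimes> (n \<otimes> x s)"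
      using y by (auto simp: bruhat_form_def)
    have [simp]: "n \<in> carrier G" using n by (auto simp: torus_elem_def weyl_elem_def)
    define u v where "u = - inverse r" and "v = t - u"
    have u: "u \<noteq> 0" using False by (simp add: u_def)
    have yg: "y r \<otimes> g = x (- u) \<otimes> (w u \<otimes> (x v \<otimes> (n \<otimes> x s)))"
      using False y_eq_xwx[OF False] by (simp add: g m_assoc xy_add u_def v_def add.commute)
    consider "torus_elem e n" | "weyl_elem e n" "v = 0" | "weyl_elem e n" "v \<noteq> 0"
      using n by blast
    then show ?thesis
    proof cases
      case 1
      \<comment> \<open>A torus element normalizes the root subgroup, so \<open>x v\<close> can be
        moved to the right end.\<close>
      then have "x v \<otimes> n = n \<otimes> x (v / e\<^sup>2)"
        by (simp add: torus_elem_def)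
      then have "x v \<otimes> (n \<otimes> x s) = n \<otimes> (x (v / e\<^sup>2) \<otimes> x s)"
        by (simp flip: m_assoc)
      then have "y r \<otimes> g = x (- u) \<otimes> ((w u \<otimes> n) \<otimes> x (v / e\<^sup>2 + s))"
        by (simp add: yg m_assoc x_add)
      with weyl_times_torus[OF u 1] show ?thesis
        by (rule bruhat_formI(2))
    next
      case 2
      have "y r \<otimes> g = x (- u) \<otimes> ((w u \<otimes> n) \<otimes> x s)"
        by (simp add: yg m_assoc \<open>v = 0\<close>)
      with weyl_times_weyl[OF u 2(1)] show ?thesis
        by (rule bruhat_formI(1))
    next
      case 3
      \<comment> \<open>Here \<open>w u\<close> carries \<open>x v\<close> to \<open>y c\<close>
        with \<open>c\<close> nonzero, while \<open>w u \<otimes> n\<close> is a torus element. A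
        second use of \<open>y_eq_xwx\<close>, on \<open>y c\<close>, lands in the big cell.\<close>
      define c where "c = - (v / u\<^sup>2)"
      have c: "c \<noteq> 0" using u 3 by (simp add: c_def)
      define n' where "n' = w u \<otimes> n"
      define e' where "e' = - u / e"
      have n': "torus_elem e' n'" unfolding n'_def e'_def by (rule weyl_times_weyl[OF u 3(1)])
      then have [simp]: "n' \<in> carrier G" and e': "e' \<noteq> 0" by (auto simp: torus_elem_def)
      have m: "x (inverse c) \<otimes> n' = n' \<otimes> x (inverse c / e'\<^sup>2)"
        using n' e' by (simp add: torus_elem_def)
      have "y r \<otimes> g = x (- u) \<otimes> (y c \<otimes> (n' \<otimes> x s))"
        using u by (simp add: yg w_x_left c_def n'_def m_assoc)
      also have "\<dots> = x (- u + inverse c) \<otimes> (w (- inverse c) \<otimes> ((x (inverse c) \<otimes> n') \<otimes> x s))"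
        by (simp add: y_eq_xwx[OF c] m_assoc xy_add)
      also have "\<dots> = x (- u + inverse c) \<otimes> ((w (- inverse c) \<otimes> n') \<otimes> x (inverse c / e'\<^sup>2 + s))"
        unfolding m by (simp add: m_assoc xy_add)
      finally show ?thesis
        using c by (intro bruhat_formI(2)[OF weyl_times_torus[OF _ n', of "- inverse c"]]) simp_all
    qed
  qed
qed

lemma central_if_commutes:
  assumes z: "z \<in> carrier G" and "\<And>t. z \<otimes> x t = x t \<otimes> z" "\<And>t. z \<otimes> y t = y t \<otimes> z" and g: "g \<in> carrier G"
  shows "z \<otimes> g = g \<otimes> z"
  using g
proof (induction rule: generated)
  case one then show ?case using z by simp
next
  case (x t g)
  have "z \<otimes> (x t \<otimes> g) = (z \<otimes> x t) \<otimes> g" using x z by (simp add: m_assoc)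
  also have "\<dots> = (x t \<otimes> g) \<otimes> z" using x z by (simp add: assms(2) m_assoc)
  finally show ?case .
next
  case (y t g)
  have "z \<otimes> (y t \<otimes> g) = (z \<otimes> y t) \<otimes> g" using y z by (simp add: m_assoc)
  also have "\<dots> = (y t \<otimes> g) \<otimes> z" using y z by (simp add: assms(3) m_assoc)
  finally show ?case .
qed

text \<open>In the Bruhat form of \<open>z\<close> a Weyl element would give a nonzero lower left
  matrix entry. So \<open>n\<close> is a torus element with parameter 1, hence acts trivially on
  both root subgroups, and the outer factors are inverse to each other; thus
  \<open>z = n\<close>.\<close>

lemma kernel_central:
  assumes z: "z \<in> carrier G" "\<phi> z = mat2 1 0 0 1" and g: "g \<in> carrier G"
  shows "z \<otimes> g = g \<otimes> z"
proof -
  obtain t n s e where n: "torus_elem e n \<or> weyl_elem e n" and zn: "z = x t \<otimes> (n \<otimes> x s)"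
    using bruhat[OF z(1)] by (auto simp: bruhat_form_def)
  have [simp]: "n \<in> carrier G" using n by (auto simp: torus_elem_def weyl_elem_def)
  have m: "mat2 1 t 0 1 ** (\<phi> n ** mat2 1 s 0 1) = mat2 1 0 0 1"
    using z by (simp add: zn phi_x mult_SL2)
  have "\<not> weyl_elem e n"
    using m by (auto simp: weyl_elem_def mat2_mult mat2_eq)
  with n have n: "torus_elem e n" by blast
  with m have "e = 1" "t = - s"
    by (auto simp: torus_elem_def mat2_mult mat2_eq eq_neg_iff_add_eq_0 add.commute)
  with n have c: "n \<otimes> x r = x r \<otimes> n" "n \<otimes> y r = y r \<otimes> n" for r
    by (simp_all add: torus_elem_def)
  have "z = n" using \<open>t = - s\<close> c(1) by (simp add: zn flip: m_assoc) (simp add: m_assoc xy_add)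
  then show ?thesis using central_if_commutes[OF _ c g] by simp
qed

text \<open>A torus element acts on the root subgroups through the square of its parameter.\<close>

lemma h_minus_one_central:
  assumes "g \<in> carrier G" shows "h (- 1) \<otimes> g = g \<otimes> h (- 1)"
proof -
  have "torus_elem (- 1) (h (- 1))"
    by (rule torus_elem_h) simp
  then show ?thesis
    using assms by (simp add: central_if_commutes torus_elem_def)
qed

lemma eq_image_imp_kernel_mult:
  "g \<in> carrier G \<Longrightarrow> g' \<in> carrier G \<Longrightarrow> \<phi> g = \<phi> g' \<Longrightarrow> \<exists>c\<in>carrier G. \<phi> c = mat2 1 0 0 1 \<and> g = c \<otimes> g'"
  by (rule bexI[of _ "g \<otimes> inv g'"]) (simp_all add: m_assoc, simp_all add: SL2_def mat2_one)

text \<open>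
  Modulo the central elements \<open>ker \<phi>\<close> and \<open>h (- 1)\<close>, \<open>h a\<close> is \<open>h (- a)\<close>, and
  \<open>(1 + a) + (- a) = 1\<close>.
\<close>

lemma h_commute:
  assumes "a \<noteq> 0" "1 + a \<noteq> 0"
  shows "h (1 + a) \<otimes> h a = h a \<otimes> h (1 + a)"
proof -
  have "h (1 + a) \<otimes> h (- a) = h (- a) \<otimes> h (1 + a)"
    using assms steinberg_relation[of "1 + a" "- a"] steinberg_relation[of "- a" "1 + a"]
    by (simp add: mult.commute)
  moreover obtain c where c: "c \<in> carrier G" "\<phi> c = mat2 1 0 0 1" "h (- a) = c \<otimes> (h a \<otimes> h (- 1))"
    using assms eq_image_imp_kernel_mult[of "h (- a)" "h a \<otimes> h (- 1)"]
    by (auto simp: phi_h mult_SL2 mat2_mult)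
  have r: "h (- 1) \<otimes> h (1 + a) = h (1 + a) \<otimes> h (- 1)" "h (1 + a) \<otimes> c = c \<otimes> h (1 + a)"
    using h_minus_one_central kernel_central[OF c(1,2), of "h (1 + a)"] by simp_all
  have "h (1 + a) \<otimes> h (- a) = c \<otimes> (h (1 + a) \<otimes> h a) \<otimes> h (- 1)"
    using c(1) r(2) by (simp add: c(3)) (simp flip: m_assoc)
  moreover have "h (- a) \<otimes> h (1 + a) = c \<otimes> (h a \<otimes> h (1 + a)) \<otimes> h (- 1)"
    using c(1) r(1) by (simp add: c(3) m_assoc)
  ultimately show ?thesis using c(1) by simp
qed

lemma h_conjugator:
  assumes "a \<noteq> 0" "1 + a \<noteq> 0" "1 - a\<^sup>2 \<noteq> 0"
  shows "(h (1 + a) \<otimes> x (a / (1 - a\<^sup>2)) \<otimes> y a) \<otimes> (w (- 1) \<otimes> x (a + inverse a))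
    = h a \<otimes> (h (1 + a) \<otimes> x (a / (1 - a\<^sup>2)) \<otimes> y a)" (is "?e \<otimes> _ = _")
proof -
  define c where "c = a / (1 - a\<^sup>2)"
  \<comment> \<open>This equation determines \<open>c\<close>: it makes \<open>x c\<close> conjugate
    \<open>x (- a) \<otimes> h a\<close> to \<open>h a\<close>. The factor \<open>h (1 + a)\<close>
    commutes with \<open>h a\<close> and so does not disturb this.\<close>
  have c: "c - a = a\<^sup>2 * c" using assms(3) by (simp add: c_def field_simps)
  have "?e \<otimes> (w (- 1) \<otimes> x (a + inverse a)) = h (1 + a) \<otimes> (x c \<otimes> (x (- a) \<otimes> h a \<otimes> y a))"
    by (simp add: m_assoc c_def flip: y_w_x_eq[OF assms(1)])
  also have "\<dots> = h (1 + a) \<otimes> (h a \<otimes> (x c \<otimes> y a))"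
    using assms(1) by (simp add: m_assoc xy_add c h_x_left)
  also have "\<dots> = (h (1 + a) \<otimes> h a) \<otimes> (x c \<otimes> y a)"
    by (simp add: m_assoc)
  also have "\<dots> = h a \<otimes> ?e"
    unfolding h_commute[OF assms(1,2)] by (simp add: m_assoc c_def)
  finally show ?thesis .
qed

end

section \<open>The group $St(2,F)$ and its central subgroup $K_2(2,F)$\<close>

abbreviation St_x12 :: "'a::field \<Rightarrow> (root \<times> 'a) word set" where
  "St_x12 t \<equiv> pres_class steinberg_rels (x_word R12 t)"

abbreviation St_x21 :: "'a::field \<Rightarrow> (root \<times> 'a) word set" where
  "St_x21 t \<equiv> pres_class steinberg_rels (x_word R21 t)"

lemma pres_class_St2: "pres_class steinberg_rels u \<in> carrier St2"
  by (simp add: St2_def presented_group_def)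

lemma St2_mult:
  "pres_class steinberg_rels u \<otimes>\<^bsub>St2\<^esub> pres_class steinberg_rels v = pres_class steinberg_rels (u @ v)"
  unfolding St2_def by (rule pres_mult)

lemma steinberg_group_St2: "steinberg_group St2 St_x12 (St_x21 :: 'a::field \<Rightarrow> _)"
proof (intro steinberg_group.intro steinberg_group_axioms.intro)
  show "group (St2 :: (root \<times> 'a) word set monoid)"
    unfolding St2_def by (rule group_presented_group)
  have add: "pres_class steinberg_rels (x_word r a) \<otimes>\<^bsub>St2\<^esub> pres_class steinberg_rels (x_word r b)
      = pres_class steinberg_rels (x_word r (a + b))" for r and a b :: 'a
    unfolding St2_mult pres_class_eq by (rule pres_eq.rel) (auto simp: steinberg_rels_def)
  show "St_x12 a \<otimes>\<^bsub>St2\<^esub> St_x12 b = St_x12 (a + b)" "St_x21 a \<otimes>\<^bsub>St2\<^esub> St_x21 b = St_x21 (a + b)"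
    for a b :: 'a
    by (rule add)+
  show "St_x12 u \<otimes>\<^bsub>St2\<^esub> St_x21 (- inverse u) \<otimes>\<^bsub>St2\<^esub> St_x12 u \<otimes>\<^bsub>St2\<^esub> St_x12 t \<otimes>\<^bsub>St2\<^esub>
      (St_x12 (- u) \<otimes>\<^bsub>St2\<^esub> St_x21 (inverse u) \<otimes>\<^bsub>St2\<^esub> St_x12 (- u)) = St_x21 (- (t / u\<^sup>2))"
    if "u \<noteq> 0" for u t :: 'a
  proof -
    have "(w_word R12 u @ x_word R12 t @ w_word R12 (- u), x_word (opp R12) (- (inverse u)\<^sup>2 * t))
        \<in> steinberg_rels"
      using that unfolding steinberg_rels_def by blast
    moreover have "- (inverse u)\<^sup>2 * t = - (t / u\<^sup>2)"
      by (simp add: divide_inverse power_inverse)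
    ultimately show ?thesis
      unfolding St2_mult pres_class_eq by (intro pres_eq.rel) (simp add: w_word_def)
  qed
qed (rule pres_class_St2)+

lemma St2_to_SL2_hom: "St2_to_SL2 \<in> hom St2 (SL2 :: ('a::field ^ 2 ^ 2) monoid)"
proof (rule homI)
  fix X Y :: "(root \<times> 'a) word set"
  assume "X \<in> carrier St2" "Y \<in> carrier St2"
  then obtain u v where "X = pres_class steinberg_rels u" "Y = pres_class steinberg_rels v"
    by (auto simp: St2_def presented_group_def)
  then show "St2_to_SL2 (X \<otimes>\<^bsub>St2\<^esub> Y) = St2_to_SL2 X \<otimes>\<^bsub>SL2\<^esub> St2_to_SL2 Y"
    by (simp add: St2_mult St2_to_SL2_class group.word_eval_append[OF group_SL2 elem_mat_SL2])
next
  fix X :: "(root \<times> 'a) word set"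
  assume "X \<in> carrier St2"
  then obtain u where "X = pres_class steinberg_rels u"
    by (auto simp: St2_def presented_group_def)
  then show "St2_to_SL2 X \<in> carrier SL2"
    by (simp add: St2_to_SL2_class group.word_eval_closed[OF group_SL2 elem_mat_SL2])
qed

text \<open>Both classes are right inverse to the same element. Words can therefore be written with
  positive letters only, which is what the induction in \<open>St2_generated\<close> rests
  on.\<close>

lemma pres_class_inverse_letter:
  "pres_class steinberg_rels [((r, t), False)] = pres_class steinberg_rels (x_word r (- t))"
proof -
  interpret steinberg_group St2 St_x12 "St_x21 :: 'a \<Rightarrow> _"
    by (rule steinberg_group_St2)
  have "pres_class steinberg_rels (x_word r t) \<otimes>\<^bsub>St2\<^esub> pres_class steinberg_rels [((r, t), False)] = \<one>\<^bsub>St2\<^esub>"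
    using pres_eq.cancel[of steinberg_rels "(r, t)" True]
    by (simp add: St2_mult x_word_def pres_class_eq) (simp add: St2_def presented_group_def pres_class_eq)
  moreover have "pres_class steinberg_rels (x_word r t) \<otimes>\<^bsub>St2\<^esub> pres_class steinberg_rels (x_word r (- t)) = \<one>\<^bsub>St2\<^esub>"
    by (cases r) (simp_all add: x_add y_add)
  ultimately show ?thesis
    by (metis Units_eq Units_l_cancel pres_class_St2)
qed

lemma St2_generated:
  assumes g: "g \<in> carrier St2" and one: "P \<one>\<^bsub>St2\<^esub>"
    and x12: "\<And>t g. g \<in> carrier St2 \<Longrightarrow> P g \<Longrightarrow> P (St_x12 t \<otimes>\<^bsub>St2\<^esub> g)"
    and x21: "\<And>t g. g \<in> carrier St2 \<Longrightarrow> P g \<Longrightarrow> P (St_x21 t \<otimes>\<^bsub>St2\<^esub> g)"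
  shows "P g"
proof -
  obtain u where "g = pres_class steinberg_rels u"
    using g by (auto simp: St2_def presented_group_def)
  moreover have "P (pres_class steinberg_rels u)"
  proof (induction u)
    case Nil
    then show ?case using one by (simp add: St2_def presented_group_def)
  next
    case (Cons l u)
    obtain r t e where l: "l = ((r, t), e)" by (metis surj_pair)
    have "pres_class steinberg_rels (l # u) = pres_class steinberg_rels [l] \<otimes>\<^bsub>St2\<^esub> pres_class steinberg_rels u"
      by (simp add: St2_mult)
    also have "pres_class steinberg_rels [l] = pres_class steinberg_rels (x_word r (if e then t else - t))"
      by (simp add: l pres_class_inverse_letter) (simp add: x_word_def)
    finally show ?case
      using x12[OF pres_class_St2 Cons.IH] x21[OF pres_class_St2 Cons.IH] by (cases r) simp_all
  qed
  ultimately show ?thesis by simp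
qed

interpretation St: steinberg_group_over_SL2 St2 St_x12 "St_x21 :: 'a::field \<Rightarrow> _" St2_to_SL2
proof (intro steinberg_group_over_SL2.intro steinberg_group_over_SL2_axioms.intro steinberg_group_St2
    group_hom.intro group_hom_axioms.intro St2_to_SL2_hom group_SL2)
  show "group (St2 :: (root \<times> 'a) word set monoid)"
    unfolding St2_def by (rule group_presented_group)
  show "St2_to_SL2 (St_x12 t) = mat2 1 t 0 1" "St2_to_SL2 (St_x21 t) = mat2 1 0 t 1" for t :: 'a
    by (simp_all add: St2_to_SL2_class word_eval_def x_word_def SL2_def)
qed (rule St2_generated)

lemma St_h12_eq: "St_h12 u = St.h u"
proof -
  have "St_w12 v = St.w v" for v :: 'a
    by (simp add: St_w12_def St.w_def w_word_def St2_mult)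
  then show ?thesis by (simp add: St_h12_def St.h_def)
qed

lemma carrier_K2_2: "carrier K2_2 = {z \<in> carrier St2. St2_to_SL2 z = mat2 1 0 0 1}"
  by (auto simp: K2_2_def kernel_def SL2_def mat2_one)

lemma mult_K2_2: "g \<otimes>\<^bsub>K2_2\<^esub> g' = g \<otimes>\<^bsub>St2\<^esub> g'"
  by (simp add: K2_2_def)

lemma subgroup_K2_2: "subgroup (carrier K2_2) St2"
  using St.phi.subgroup_kernel by (simp add: K2_2_def)

lemma K2_2_central: "c \<in> carrier K2_2 \<Longrightarrow> g \<in> carrier St2 \<Longrightarrow> c \<otimes>\<^bsub>St2\<^esub> g = g \<otimes>\<^bsub>St2\<^esub> c"
  by (rule St.kernel_central) (simp_all add: carrier_K2_2)

lemma comm_group_K2_2: "comm_group K2_2"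
proof (rule group.group_comm_groupI)
  show "group K2_2"
    using St.subgroup_imp_group[OF subgroup_K2_2] by (simp add: K2_2_def)
  show "g \<otimes>\<^bsub>K2_2\<^esub> g' = g' \<otimes>\<^bsub>K2_2\<^esub> g" if "g \<in> carrier K2_2" "g' \<in> carrier K2_2"
    for g g' :: "(root \<times> 'a) word set"
    unfolding mult_K2_2 by (rule K2_2_central) (use that in \<open>simp_all add: carrier_K2_2\<close>)
qed

interpretation K2: comm_group K2_2
  by (rule comm_group_K2_2)

lemma inv_K2_2: "c \<in> carrier K2_2 \<Longrightarrow> inv\<^bsub>K2_2\<^esub> c = inv\<^bsub>St2\<^esub> c"
  using St.m_inv_consistent[OF subgroup_K2_2] by (simp add: K2_2_def)

section \<open>Homomorphisms out of free abelian groups\<close>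

definition power_product :: "('g, 'm) monoid_scheme \<Rightarrow> ('p \<Rightarrow> 'g) \<Rightarrow> ('p \<Rightarrow>\<^sub>0 int) \<Rightarrow> 'g" where
  "power_product G f z = finprod G (\<lambda>p. f p [^]\<^bsub>G\<^esub> Poly_Mapping.lookup z p) (Poly_Mapping.keys z)"

context comm_group
begin

text \<open>Symbols outside the support contribute a zeroth power, so chains with different supports
  can be compared over one finite index set.\<close>

lemma power_product_superset:
  assumes f: "f \<in> S \<rightarrow> carrier G" and "finite A" "Poly_Mapping.keys z \<subseteq> A" "A \<subseteq> S"
  shows "power_product G f z = (\<Otimes>p\<in>A. f p [^] Poly_Mapping.lookup z p)"
  unfolding power_product_def
proof (rule finprod_mono_neutral_cong_left)
  have "f p \<in> carrier G" if "p \<in> A" for p using assms that by auto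
  then show "(\<lambda>p. f p [^] Poly_Mapping.lookup z p) \<in> A \<rightarrow> carrier G" by auto
qed (use assms in \<open>auto simp: in_keys_iff\<close>)

text \<open>This is applied twice with values in \<open>K2_2\<close>: to the cocycle on 2-symbols,
  where it is \<open>cocycle_eval\<close>, and to \<open>defect\<close> on elements of
  \<open>St2\<close>.\<close>

lemma power_product_hom:
  assumes f: "f \<in> S \<rightarrow> carrier G"
  shows "power_product G f \<in> hom (free_Abelian_group S) G"
proof (rule homI)
  fix z z' assume "z \<in> carrier (free_Abelian_group S)" "z' \<in> carrier (free_Abelian_group S)"
  then have S: "Poly_Mapping.keys z \<union> Poly_Mapping.keys z' \<subseteq> S" (is "?A \<subseteq> S") by simp
  have fA: "f p \<in> carrier G" if "p \<in> ?A" for p using f S that by blast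
  have "power_product G f (z + z') = (\<Otimes>p\<in>?A. f p [^] Poly_Mapping.lookup (z + z') p)"
    using S keys_add[of z z'] by (intro power_product_superset[OF f]) auto
  also have "\<dots> = (\<Otimes>p\<in>?A. f p [^] Poly_Mapping.lookup z p \<otimes> f p [^] Poly_Mapping.lookup z' p)"
    by (rule finprod_cong') (use fA in \<open>auto simp: Poly_Mapping.lookup_add int_pow_mult\<close>)
  also have "\<dots> = (\<Otimes>p\<in>?A. f p [^] Poly_Mapping.lookup z p) \<otimes> (\<Otimes>p\<in>?A. f p [^] Poly_Mapping.lookup z' p)"
    using fA by (intro finprod_multf) auto
  also have "\<dots> = power_product G f z \<otimes> power_product G f z'"
    using S by (simp add: power_product_superset[OF f, of ?A])
  finally show "power_product G f (z \<otimes>\<^bsub>free_Abelian_group S\<^esub> z') = power_product G f z \<otimes> power_product G f z'"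
    by simp
next
  fix z assume "z \<in> carrier (free_Abelian_group S)"
  then show "power_product G f z \<in> carrier G"
    using f by (auto simp: power_product_def intro!: finprod_closed int_pow_closed)
qed

lemma power_product_add:
  assumes "f \<in> S \<rightarrow> carrier G" "Poly_Mapping.keys z \<subseteq> S" "Poly_Mapping.keys z' \<subseteq> S"
  shows "power_product G f (z + z') = power_product G f z \<otimes> power_product G f z'"
  using hom_mult[OF power_product_hom[OF assms(1)], of z z'] assms by simp

lemma power_product_diff:
  assumes f: "f \<in> S \<rightarrow> carrier G" and z: "Poly_Mapping.keys z \<subseteq> S" "Poly_Mapping.keys z' \<subseteq> S"
  shows "power_product G f (z - z') = power_product G f z \<otimes> inv (power_product G f z')"
proof -
  have closed: "power_product G f u \<in> carrier G" if "Poly_Mapping.keys u \<subseteq> S" for u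
    using hom_in_carrier[OF power_product_hom[OF f], of u] that by simp
  have d: "Poly_Mapping.keys (z - z') \<subseteq> S"
    using keys_diff[of z z'] z by auto
  have "power_product G f (z - z') \<otimes> power_product G f z' = power_product G f z"
    using power_product_add[OF f d z(2)] by simp
  then show ?thesis
    by (metis closed d z inv_closed inv_solve_right)
qed

lemma power_product_frag_of:
  "f p \<in> carrier G \<Longrightarrow> power_product G f (frag_of p) = f p"
  by (simp add: power_product_def)

end

section \<open>Evaluation of the cocycle through lifts of chains\<close>

lemma bar_boundary_add_diff:
  "bar_boundary G n (u + v) = bar_boundary G n u + bar_boundary G n v"
  "bar_boundary G n (u - v) = bar_boundary G n u - bar_boundary G n v"
  by (simp_all add: bar_boundary_def frag_extend_add frag_extend_diff)

lemma bar_boundary_3: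
  "bar_boundary G 3 (frag_of [g, h, k]) = frag_of [h, k] - frag_of [g \<otimes>\<^bsub>G\<^esub> h, k]
     + frag_of [g, h \<otimes>\<^bsub>G\<^esub> k] - frag_of [g, h]"
  by (simp add: bar_boundary_def bar_face_def numeral_3_eq_3 algebra_simps)

lemma homology_class_eq:
  "homology_class n G z = (\<lambda>b. b + z) ` bar_boundaries G n"
  by (auto simp: homology_class_def r_coset_def bar_cycle_group_def bar_chain_group_def)

locale steinberg_section =
  fixes s :: "'a::field ^ 2 ^ 2 \<Rightarrow> (root \<times> 'a) word set"
  assumes is_section: "is_section s"
begin

definition defect :: "(root \<times> 'a) word set \<Rightarrow> (root \<times> 'a) word set" where
  "defect g = s (St2_to_SL2 g) \<otimes>\<^bsub>St2\<^esub> inv\<^bsub>St2\<^esub> g"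

lemma section_closed [simp]: "g \<in> carrier St2 \<Longrightarrow> s (St2_to_SL2 g) \<in> carrier St2"
  and section_lift [simp]: "g \<in> carrier St2 \<Longrightarrow> St2_to_SL2 (s (St2_to_SL2 g)) = St2_to_SL2 g"
  using is_section St.phi.hom_closed[of g] by (auto simp: is_section_def)

lemma defect_closed: "g \<in> carrier St2 \<Longrightarrow> defect g \<in> carrier K2_2"
  by (simp add: defect_def carrier_K2_2 mat2_one[symmetric]) (simp add: SL2_def)

lemma defect_closed_St2 [simp]: "g \<in> carrier St2 \<Longrightarrow> defect g \<in> carrier St2"
  by (simp add: defect_def)

lemma section_eq_defect: "g \<in> carrier St2 \<Longrightarrow> s (St2_to_SL2 g) = defect g \<otimes>\<^bsub>St2\<^esub> g"
  by (simp add: defect_def St.m_assoc)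

text \<open>Each value of \<open>s\<close> is a central defect times the given lift; the defects can
  be moved aside and the lifts cancel. So the cocycle becomes a coboundary when pulled back to
  \<open>St2\<close>.\<close>

lemma section_cocycle_eq:
  assumes g: "g \<in> carrier St2" "g' \<in> carrier St2"
  shows "section_cocycle s [St2_to_SL2 g, St2_to_SL2 g'] =
    defect g \<otimes>\<^bsub>K2_2\<^esub> defect g' \<otimes>\<^bsub>K2_2\<^esub> inv\<^bsub>K2_2\<^esub> (defect (g \<otimes>\<^bsub>St2\<^esub> g'))"
proof -
  let ?c = "defect (g \<otimes>\<^bsub>St2\<^esub> g')"
  have "section_cocycle s [St2_to_SL2 g, St2_to_SL2 g'] = s (St2_to_SL2 g) \<otimes>\<^bsub>St2\<^esub> s (St2_to_SL2 g')
      \<otimes>\<^bsub>St2\<^esub> inv\<^bsub>St2\<^esub> (s (St2_to_SL2 (g \<otimes>\<^bsub>St2\<^esub> g')))"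
    using g by (simp add: section_cocycle_def)
  also have "\<dots> = (defect g \<otimes>\<^bsub>St2\<^esub> g) \<otimes>\<^bsub>St2\<^esub> (defect g' \<otimes>\<^bsub>St2\<^esub> g')
      \<otimes>\<^bsub>St2\<^esub> inv\<^bsub>St2\<^esub> (?c \<otimes>\<^bsub>St2\<^esub> (g \<otimes>\<^bsub>St2\<^esub> g'))"
    using g by (simp only: section_eq_defect St.m_closed)
  also have "\<dots> = defect g \<otimes>\<^bsub>St2\<^esub> (g \<otimes>\<^bsub>St2\<^esub> defect g') \<otimes>\<^bsub>St2\<^esub> inv\<^bsub>St2\<^esub> g \<otimes>\<^bsub>St2\<^esub> inv\<^bsub>St2\<^esub> ?c"
    using g by (simp add: St.m_assoc St.inv_mult_group St.inv_cancel_left)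
  also have "g \<otimes>\<^bsub>St2\<^esub> defect g' = defect g' \<otimes>\<^bsub>St2\<^esub> g"
    using g K2_2_central[OF defect_closed] by simp
  finally show ?thesis
    using g by (simp add: St.m_assoc mult_K2_2 inv_K2_2 defect_closed)
qed

section \<open>Lifting chains, and independence of the representative\<close>

definition bar_symbols :: "('a ^ 2 ^ 2) list set" where
  "bar_symbols = {gs. length gs = 2 \<and> set gs \<subseteq> carrier SL2}"

lemma cocycle_eval_eq: "cocycle_eval s = power_product K2_2 (section_cocycle s)"
  by (simp add: cocycle_eval_def power_product_def fun_eq_iff)

lemma section_cocycle_closed: "section_cocycle s \<in> bar_symbols \<rightarrow> carrier K2_2"
proof
  fix p :: "('a ^ 2 ^ 2) list" assume "p \<in> bar_symbols"
  then obtain X Y where p: "p = [X, Y]" "X \<in> carrier SL2" "Y \<in> carrier SL2"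
    by (auto simp: bar_symbols_def length_Suc_conv numeral_2_eq_2)
  then have "s X \<in> carrier St2" "s Y \<in> carrier St2" "St2_to_SL2 (s X) = X" "St2_to_SL2 (s Y) = Y"
    using is_section by (auto simp: is_section_def)
  then show "section_cocycle s p \<in> carrier K2_2"
    using section_cocycle_eq[of "s X" "s Y"] by (simp add: p(1) defect_closed)
qed

abbreviation defect_product :: "((root \<times> 'a) word set \<Rightarrow>\<^sub>0 int) \<Rightarrow> (root \<times> 'a) word set" where
  "defect_product \<equiv> power_product K2_2 defect"

lemma defect_funcset: "defect \<in> carrier St2 \<rightarrow> carrier K2_2"
  by (simp add: defect_closed)

text \<open>
  Writing a 2-chain of \<open>SL2\<close> with symbols \<open>[\<phi> g|\<phi> g']\<close>, the chain \<open>q\<close> below is the boundary of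
  the corresponding combination of \<open>[g|g']\<close> in \<open>St2\<close>.
\<close>

definition lifts :: "(('a ^ 2 ^ 2) list \<Rightarrow>\<^sub>0 int) \<Rightarrow> ((root \<times> 'a) word set \<Rightarrow>\<^sub>0 int) \<Rightarrow> bool" where
  "lifts z q \<longleftrightarrow> Poly_Mapping.keys z \<subseteq> bar_symbols \<and> Poly_Mapping.keys q \<subseteq> carrier St2
     \<and> cocycle_eval s z = defect_product q"

lemma lifts_zero: "lifts 0 0"
  by (simp add: lifts_def cocycle_eval_eq power_product_def)

lemma lifts_add: "lifts z q \<Longrightarrow> lifts z' q' \<Longrightarrow> lifts (z + z') (q + q')"
  using keys_add[of z z'] keys_add[of q q']
  by (simp add: lifts_def cocycle_eval_eq K2.power_product_add[OF section_cocycle_closed]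
      K2.power_product_add[OF defect_funcset]) blast

lemma lifts_diff: "lifts z q \<Longrightarrow> lifts z' q' \<Longrightarrow> lifts (z - z') (q - q')"
  using keys_diff[of z z'] keys_diff[of q q']
  by (simp add: lifts_def cocycle_eval_eq K2.power_product_diff[OF section_cocycle_closed]
      K2.power_product_diff[OF defect_funcset]) blast

lemma defect_product_frag_of [simp]: "g \<in> carrier St2 \<Longrightarrow> defect_product (frag_of g) = defect g"
  by (simp add: K2.power_product_frag_of defect_closed)

text \<open>The product is a separate variable \<open>g''\<close> so that each use can name it in
  the form in which the terms of a larger chain cancel.\<close>

lemma lifts_frag_of:
  assumes g: "g \<in> carrier St2" "g' \<in> carrier St2" and X: "St2_to_SL2 g = X" "St2_to_SL2 g' = Y"
    and p: "g \<otimes>\<^bsub>St2\<^esub> g' = g''"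
  shows "lifts (bar2 X Y) (frag_of g + frag_of g' - frag_of g'')"
proof -
  have g'': "g'' \<in> carrier St2" using g p by auto
  have XY: "[X, Y] \<in> bar_symbols" using g X by (auto simp: bar_symbols_def)
  have sub: "Poly_Mapping.keys (frag_of g + frag_of g') \<subseteq> carrier St2"
    using keys_add[of "frag_of g" "frag_of g'"] g by auto
  then have "Poly_Mapping.keys (frag_of g + frag_of g' - frag_of g'') \<subseteq> carrier St2"
    using keys_diff[of "frag_of g + frag_of g'" "frag_of g''"] g'' by auto
  moreover have "cocycle_eval s (bar2 X Y) = section_cocycle s [X, Y]"
    unfolding cocycle_eval_eq
    by (rule K2.power_product_frag_of) (use XY section_cocycle_closed in blast)
  moreover have "defect_product (frag_of g + frag_of g' - frag_of g'')
      = defect g \<otimes>\<^bsub>K2_2\<^esub> defect g' \<otimes>\<^bsub>K2_2\<^esub> inv\<^bsub>K2_2\<^esub> (defect g'')"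
    using g g'' sub by (simp add: K2.power_product_add[OF defect_funcset] K2.power_product_diff[OF defect_funcset])
  ultimately show ?thesis
    using XY section_cocycle_eq[OF g] by (simp add: lifts_def X p)
qed

text \<open>Lifting a 3-symbol entrywise by \<open>s\<close> reduces the claim to the vanishing of
  the double boundary in the bar complex of \<open>St2\<close>; associativity there takes the place
  of a check of the cocycle identity.\<close>

lemma lifts_boundary:
  assumes "b \<in> bar_boundaries SL2 2"
  shows "lifts b 0"
proof -
  let ?S = "{gs. length gs = 3 \<and> set gs \<subseteq> carrier (SL2 :: ('a ^ 2 ^ 2) monoid)}"
  obtain c where c: "Poly_Mapping.keys c \<subseteq> ?S" and b: "b = bar_boundary SL2 3 c"
    using assms by (auto simp: bar_boundaries_def bar_chain_group_def)
  have "lifts (bar_boundary SL2 3 c) 0"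
    using c
  proof (induction rule: frag_induction)
    case zero
    then show ?case using lifts_zero by (simp add: bar_boundary_def)
  next
    case (diff u v)
    then show ?case using lifts_diff[of _ 0 _ 0] by (simp add: bar_boundary_add_diff)
  next
    case (one gs)
    then obtain X Y Z where gs: "gs = [X, Y, Z]" and X: "X \<in> carrier SL2" "Y \<in> carrier SL2" "Z \<in> carrier SL2"
      by (auto simp: length_Suc_conv numeral_3_eq_3)
    have [simp]: "s X \<in> carrier St2" "s Y \<in> carrier St2" "s Z \<in> carrier St2"
      "St2_to_SL2 (s X) = X" "St2_to_SL2 (s Y) = Y" "St2_to_SL2 (s Z) = Z"
      using X is_section by (auto simp: is_section_def)
    let ?x = "s X" and ?y = "s Y" and ?z = "s Z"
    \<comment> \<open>The four brackets are the boundaries of the four faces of the lifted symbol;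
      they add up to zero.\<close>
    have "lifts (frag_of [Y, Z] - frag_of [X \<otimes>\<^bsub>SL2\<^esub> Y, Z] + frag_of [X, Y \<otimes>\<^bsub>SL2\<^esub> Z] - frag_of [X, Y])
       ((frag_of ?y + frag_of ?z - frag_of (?y \<otimes>\<^bsub>St2\<^esub> ?z))
        - (frag_of (?x \<otimes>\<^bsub>St2\<^esub> ?y) + frag_of ?z - frag_of (?x \<otimes>\<^bsub>St2\<^esub> (?y \<otimes>\<^bsub>St2\<^esub> ?z)))
        + (frag_of ?x + frag_of (?y \<otimes>\<^bsub>St2\<^esub> ?z) - frag_of (?x \<otimes>\<^bsub>St2\<^esub> (?y \<otimes>\<^bsub>St2\<^esub> ?z)))
        - (frag_of ?x + frag_of ?y - frag_of (?x \<otimes>\<^bsub>St2\<^esub> ?y)))"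
      by (intro lifts_add lifts_diff lifts_frag_of) (simp_all add: St.m_assoc)
    then show ?case by (simp add: gs bar_boundary_3)
  qed
  then show ?thesis by (simp add: b)
qed

text \<open>Boundaries lift to 0, so the value is constant on the whole coset and
  \<open>the_elem\<close> returns it.\<close>

lemma H2_to_K2_eq:
  assumes "lifts z q"
  shows "H2_to_K2 s (homology_class 2 SL2 z) = defect_product q"
proof -
  have "cocycle_eval s (b + z) = defect_product q" if "b \<in> bar_boundaries SL2 2" for b
    using lifts_add[OF lifts_boundary[OF that] assms] by (simp add: lifts_def)
  \<comment> \<open>The coset must be nonempty for the image to be a singleton.\<close>
  moreover have "(0 :: ('a ^ 2 ^ 2) list \<Rightarrow>\<^sub>0 int) \<in> bar_boundaries SL2 2"
    unfolding bar_boundaries_def by (rule image_eqI[of _ _ 0]) (simp_all add: bar_boundary_def bar_chain_group_def)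
  ultimately have "cocycle_eval s ` homology_class 2 SL2 z = {defect_product q}"
    unfolding homology_class_eq image_image by blast
  then show ?thesis by (simp add: H2_to_K2_def)
qed

lemma defect_product_diff_frag_of:
  assumes c: "c \<in> carrier K2_2" and g: "g \<in> carrier St2"
  shows "defect_product (frag_of g - frag_of (c \<otimes>\<^bsub>St2\<^esub> g)) = c"
proof -
  let ?g = "c \<otimes>\<^bsub>St2\<^esub> g"
  have cSt: "c \<in> carrier St2" "St2_to_SL2 c = \<one>\<^bsub>SL2\<^esub>"
    using c by (simp_all add: carrier_K2_2 flip: mat2_one) (simp add: SL2_def)
  have "defect g = defect ?g \<otimes>\<^bsub>St2\<^esub> c"
    using g cSt by (simp add: defect_def St.m_assoc St.inv_mult_group)
  then have "defect_product (frag_of g - frag_of ?g) = defect ?g \<otimes>\<^bsub>K2_2\<^esub> c \<otimes>\<^bsub>K2_2\<^esub> inv\<^bsub>K2_2\<^esub> (defect ?g)"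
    using g cSt by (simp add: K2.power_product_diff[OF defect_funcset] mult_K2_2)
  also have "\<dots> = c"
    using g c cSt by (simp add: K2.m_comm[of "defect ?g" c] K2.m_assoc defect_closed)
  finally show ?thesis .
qed

section \<open>Lifts of the summands of the two cycles\<close>

abbreviation "x \<equiv> St_x12 :: 'a \<Rightarrow> _"
abbreviation "y \<equiv> St_x21 :: 'a \<Rightarrow> _"
abbreviation "w \<equiv> St.w :: 'a \<Rightarrow> _"
abbreviation "h \<equiv> St.h :: 'a \<Rightarrow> _"

lemma St2_to_SL2_simps:
  "St2_to_SL2 (x t) = E12 t" "St2_to_SL2 (y t) = Hm t"
  "u \<noteq> 0 \<Longrightarrow> St2_to_SL2 (h u) = Dm u" "St2_to_SL2 (w (- 1)) = inv\<^bsub>SL2\<^esub> wm"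
  by (simp_all add: St.phi_x St.phi_y St.phi_h St.phi_w E12_def Hm_def Dm_def wm_def inv_SL2)

lemma lifts_Psi:
  assumes "l \<noteq> 0" "l \<noteq> 1" "l \<noteq> - 1"
  shows "lifts (Psi l t) (frag_of (x t))"
proof -
  define t' where "t' = t / (l\<^sup>2 - 1)"
  have "l\<^sup>2 - 1 \<noteq> 0" using assms by (simp add: power2_eq_1_iff)
  then have t: "t + t' = l\<^sup>2 * t'" by (simp add: t'_def field_simps)
  have "lifts (Psi l t) ((frag_of (x t) + frag_of (x t' \<otimes>\<^bsub>St2\<^esub> h l) - frag_of (h l \<otimes>\<^bsub>St2\<^esub> x t'))
      - (frag_of (h l) + frag_of (x t') - frag_of (h l \<otimes>\<^bsub>St2\<^esub> x t'))
      + (frag_of (x t') + frag_of (h l) - frag_of (x t' \<otimes>\<^bsub>St2\<^esub> h l)))"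
    unfolding Psi_def Let_def t'_def[symmetric]
    by (intro lifts_add lifts_diff lifts_frag_of)
      (simp_all add: assms(1) St2_to_SL2_simps mult_SL2 St.x_add_left St.h_x t)
  then show ?thesis by simp
qed

lemma wm_Gm: "wm ** Gm a = E12 (a + inverse a)"
  and Gm_eq: "inv\<^bsub>SL2\<^esub> wm ** E12 (a + inverse a) = Gm a"
  by (simp_all add: SL2_mat_defs mat2_mult inv_SL2)

lemma lifts_Theta:
  assumes "a \<noteq> 0"
  shows "lifts (Theta a) (frag_of (w (- 1)) + frag_of (x (a + inverse a)) - frag_of (x (- a) \<otimes>\<^bsub>St2\<^esub> h a))"
proof -
  let ?g = "w (- 1) \<otimes>\<^bsub>St2\<^esub> x (a + inverse a)" and ?r = "x (- a) \<otimes>\<^bsub>St2\<^esub> h a"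
  have r: "St2_to_SL2 ?r = Rm a"
    using assms by (simp add: St2_to_SL2_simps mult_SL2 E12_def Dm_def Rm_def mat2_mult)
  have "lifts (Theta a) ((frag_of (y a) + frag_of ?g - frag_of (?r \<otimes>\<^bsub>St2\<^esub> y a))
      - (frag_of ?r + frag_of (y a) - frag_of (?r \<otimes>\<^bsub>St2\<^esub> y a))
      + (frag_of (w (- 1)) + frag_of (x (a + inverse a)) - frag_of ?g))"
    unfolding Theta_def
    by (intro lifts_add lifts_diff lifts_frag_of)
      (simp_all only: St.x_closed St.y_closed St.w_closed St.h_closed St.m_closed St2_to_SL2_simps r
        St.phi.hom_mult wm_Gm Gm_eq mult_SL2 St.y_w_x_eq[OF assms])
  then show ?thesis by simp
qed

lemma lifts_Theta_tilde:
  assumes a: "a \<noteq> 0" "a \<noteq> 1" "a \<noteq> - 1"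
  shows "lifts (Theta_tilde a) (frag_of (w (- 1)) + frag_of (x (a + inverse a)) - frag_of (h a))"
proof -
  let ?g = "w (- 1) \<otimes>\<^bsub>St2\<^esub> x (a + inverse a)"
  \<comment> \<open>The factors come from the decomposition
    \<open>Htm a = Dm (1 + a) ** E12 (a / (1 - a\<^sup>2)) ** Hm a\<close>.\<close>
  define e where "e = h (1 + a) \<otimes>\<^bsub>St2\<^esub> x (a / (1 - a\<^sup>2)) \<otimes>\<^bsub>St2\<^esub> y a"
  have [simp]: "e \<in> carrier St2" by (simp add: e_def)
  have n: "1 + a \<noteq> 0" "1 - a \<noteq> 0" "1 - a\<^sup>2 \<noteq> 0"
    using a by (auto simp: add_eq_0_iff power2_eq_1_iff)
  have f: "1 - a\<^sup>2 = (1 - a) * (1 + a)" by (simp add: power2_eq_square algebra_simps)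
  have conj: "e \<otimes>\<^bsub>St2\<^esub> ?g = h a \<otimes>\<^bsub>St2\<^esub> e"
    unfolding e_def by (rule St.h_conjugator) (use a n in simp_all)
  have r: "St2_to_SL2 e = Htm a"
    using n unfolding e_def f
    by (simp add: St2_to_SL2_simps mult_SL2 E12_def Dm_def Hm_def Htm_def mat2_mult mat2_eq)
      (simp add: field_simps)
  have "lifts (Theta_tilde a) ((frag_of e + frag_of ?g - frag_of (h a \<otimes>\<^bsub>St2\<^esub> e))
      - (frag_of (h a) + frag_of e - frag_of (h a \<otimes>\<^bsub>St2\<^esub> e))
      + (frag_of (w (- 1)) + frag_of (x (a + inverse a)) - frag_of ?g))"
    unfolding Theta_tilde_def
    by (intro lifts_add lifts_diff lifts_frag_of)
      (simp_all add: St2_to_SL2_simps r a conj wm_Gm Gm_eq mult_SL2)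
  then show ?thesis by simp
qed

section \<open>Assembly of the lifts of the two cycles\<close>

lemma lifts_F_tilde_cycle:
  assumes "a \<noteq> 0" "b \<noteq> 0" "l \<noteq> 0" "l \<noteq> 1" "l \<noteq> - 1" "a \<notin> {1, - 1}" "b \<notin> {1, - 1}" "a * b \<notin> {1, - 1}"
  shows "lifts (F_tilde_cycle a b l) (frag_of (h (a * b)) - frag_of (h a \<otimes>\<^bsub>St2\<^esub> h b))"
proof -
  \<comment> \<open>As \<open>h 1\<close> is trivial, the last term of the lift is just
    \<open>x (- 1)\<close>; it and \<open>x 2\<close> are the terms that the summands
    \<open>Psi l (- 1)\<close> and \<open>Psi l 2\<close> remove.\<close>
  have T1: "lifts (Theta 1) (frag_of (w (- 1)) + frag_of (x 2) - frag_of (x (- 1)))"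
    using lifts_Theta[of 1] by (simp del: inverse_mult_distrib)
  have D: "lifts (bar2 (Dm a) (Dm b)) (frag_of (h a) + frag_of (h b) - frag_of (h a \<otimes>\<^bsub>St2\<^esub> h b))"
    using assms by (intro lifts_frag_of) (simp_all add: St2_to_SL2_simps)
  note P = lifts_Psi[OF assms(3-5)]
  have T: "lifts (Theta_tilde c) (frag_of (w (- 1)) + frag_of (x (c + inverse c)) - frag_of (h c))"
    if "c \<in> {a, b, a * b}" for c
    using that assms by (intro lifts_Theta_tilde) auto
  \<comment> \<open>The four terms of \<open>w (- 1)\<close> cancel in pairs, and each
    \<open>Psi\<close> removes one term of \<open>x\<close>.\<close>
  have "lifts (F_tilde_cycle a b l)
     ((frag_of (h a) + frag_of (h b) - frag_of (h a \<otimes>\<^bsub>St2\<^esub> h b))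
      + (frag_of (w (- 1)) + frag_of (x (a + inverse a)) - frag_of (h a))
      + (frag_of (w (- 1)) + frag_of (x (b + inverse b)) - frag_of (h b))
      - (frag_of (w (- 1)) + frag_of (x (a * b + inverse (a * b))) - frag_of (h (a * b)))
      - (frag_of (w (- 1)) + frag_of (x 2) - frag_of (x (- 1)))
      + frag_of (x (a * b + inverse (a * b))) - frag_of (x (a + inverse a)) - frag_of (x (b + inverse b))
      + frag_of (x 2) - frag_of (x (- 1)))"
    unfolding F_tilde_cycle_def by (intro lifts_add lifts_diff P T1 D T) simp_all
  then show ?thesis by (simp add: algebra_simps del: inverse_mult_distrib)
qed

lemma lifts_F_cycle:
  assumes "a \<noteq> 0" "b \<noteq> 0" "l \<noteq> 0" "l \<noteq> 1" "l \<noteq> - 1"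
  defines "t \<equiv> inverse (a * b) * (a + inverse b - 1)"
  shows "lifts (F_cycle a b l) (frag_of (x (- (a * b)) \<otimes>\<^bsub>St2\<^esub> h (a * b))
    - frag_of ((x (- a) \<otimes>\<^bsub>St2\<^esub> h a) \<otimes>\<^bsub>St2\<^esub> (x (- b) \<otimes>\<^bsub>St2\<^esub> h b) \<otimes>\<^bsub>St2\<^esub> x t))"
proof -
  define r where "r c = x (- c) \<otimes>\<^bsub>St2\<^esub> h c" for c
  have r: "r c \<in> carrier St2" for c by (simp add: r_def)
  have phi_r: "St2_to_SL2 (r c) = Rm c" if "c \<noteq> 0" for c
    using that by (simp add: r_def St2_to_SL2_simps mult_SL2 E12_def Dm_def Rm_def mat2_mult)
  \<comment> \<open>\<open>Rm a ** Rm b\<close> and \<open>Rm (a * b)\<close> are upper triangular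
    with the same diagonal, so they differ by a unipotent factor; \<open>t\<close> is its entry, and
    the last \<open>Psi\<close> in the cycle removes the resulting term of
    \<open>x t\<close>.\<close>
  have z: "inv\<^bsub>SL2\<^esub> (Rm a ** Rm b) ** Rm (a * b) = E12 t"
    using assms by (simp add: t_def SL2_mat_defs mat2_mult inv_SL2 mat2_eq field_simps)
  note P = lifts_Psi[OF assms(3-5)]
  have T: "lifts (Theta c) (frag_of (w (- 1)) + frag_of (x (c + inverse c)) - frag_of (r c))"
    if "c \<in> {a, b, a * b}" for c
    unfolding r_def using that assms by (intro lifts_Theta) auto
  have T1: "lifts (Theta 1) (frag_of (w (- 1)) + frag_of (x 2) - frag_of (x (- 1)))"
    using lifts_Theta[of 1] by (simp del: inverse_mult_distrib)
  have R: "lifts (bar2 (Rm a) (Rm b)) (frag_of (r a) + frag_of (r b) - frag_of (r a \<otimes>\<^bsub>St2\<^esub> r b))"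
    "lifts (bar2 (Rm a ** Rm b) (inv\<^bsub>SL2\<^esub> (Rm a ** Rm b) ** Rm (a * b)))
      (frag_of (r a \<otimes>\<^bsub>St2\<^esub> r b) + frag_of (x t) - frag_of (r a \<otimes>\<^bsub>St2\<^esub> r b \<otimes>\<^bsub>St2\<^esub> x t))"
    unfolding z using assms(1,2) by (intro lifts_frag_of; simp add: r phi_r St2_to_SL2_simps mult_SL2)+
  have "lifts (F_cycle a b l)
     ((frag_of (r a) + frag_of (r b) - frag_of (r a \<otimes>\<^bsub>St2\<^esub> r b))
      + (frag_of (r a \<otimes>\<^bsub>St2\<^esub> r b) + frag_of (x t) - frag_of (r a \<otimes>\<^bsub>St2\<^esub> r b \<otimes>\<^bsub>St2\<^esub> x t))
      + (frag_of (w (- 1)) + frag_of (x (a + inverse a)) - frag_of (r a))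
      + (frag_of (w (- 1)) + frag_of (x (b + inverse b)) - frag_of (r b))
      - (frag_of (w (- 1)) + frag_of (x (a * b + inverse (a * b))) - frag_of (r (a * b)))
      - (frag_of (w (- 1)) + frag_of (x 2) - frag_of (x (- 1)))
      + frag_of (x (a * b + inverse (a * b))) - frag_of (x (a + inverse a)) - frag_of (x (b + inverse b))
      + frag_of (x 2) - frag_of (x (- 1)) - frag_of (x t))"
    unfolding F_cycle_def t_def[symmetric] by (intro lifts_add lifts_diff P T1 R T) simp_all
  then have "lifts (F_cycle a b l) (frag_of (r (a * b)) - frag_of (r a \<otimes>\<^bsub>St2\<^esub> r b \<otimes>\<^bsub>St2\<^esub> x t))"
    by (simp add: algebra_simps del: inverse_mult_distrib)
  then show ?thesis by (simp only: r_def)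
qed

section \<open>The symbol as the value on the two classes\<close>

lemma St_c_in_K2_2:
  fixes a b :: 'a
  assumes "a \<noteq> 0" "b \<noteq> 0"
  shows "St_c a b \<in> carrier K2_2"
proof -
  have "St2_to_SL2 (h a \<otimes>\<^bsub>St2\<^esub> h b) = St2_to_SL2 (h (a * b))"
    using assms by (simp add: St2_to_SL2_simps Dm_def mult_SL2 mat2_mult)
  then have "St2_to_SL2 (St_c a b) = \<one>\<^bsub>SL2\<^esub>"
    unfolding St_c_def St_h12_eq by (simp del: St.phi.hom_mult add: St.phi.hom_mult[of _ "inv\<^bsub>St2\<^esub> _"])
  then show ?thesis
    by (simp add: carrier_K2_2 St_c_def St_h12_eq flip: mat2_one) (simp add: SL2_def)
qed

lemma h_mult_h: "h a \<otimes>\<^bsub>St2\<^esub> h b = St_c a b \<otimes>\<^bsub>St2\<^esub> h (a * b)"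
  by (simp add: St_c_def St_h12_eq St.m_assoc)

text \<open>All factors \<open>x\<close> are collected on the left, each torus element scaling by
  the square of its parameter. The value of \<open>t\<close> makes the exponents add up to
  \<open>- (a * b)\<close>, and the symbol moves to the front because it is central.\<close>

lemma symbol_eq:
  assumes "a \<noteq> 0" "b \<noteq> 0"
  defines "t \<equiv> inverse (a * b) * (a + inverse b - 1)"
  shows "(x (- a) \<otimes>\<^bsub>St2\<^esub> h a) \<otimes>\<^bsub>St2\<^esub> (x (- b) \<otimes>\<^bsub>St2\<^esub> h b) \<otimes>\<^bsub>St2\<^esub> x t
    = St_c a b \<otimes>\<^bsub>St2\<^esub> (x (- (a * b)) \<otimes>\<^bsub>St2\<^esub> h (a * b))"
proof -
  have c: "St_c a b \<in> carrier St2"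
    by (simp add: St_c_def St_h12_eq)
  have central: "St_c a b \<otimes>\<^bsub>St2\<^esub> g = g \<otimes>\<^bsub>St2\<^esub> St_c a b" if "g \<in> carrier St2" for g
    using that by (rule K2_2_central[OF St_c_in_K2_2[OF assms(1,2)]])
  have t: "- a - a\<^sup>2 * b + (a * b)\<^sup>2 * t = - (a * b)"
    using assms(1,2) by (simp add: t_def field_simps power2_eq_square)
  have "(x (- a) \<otimes>\<^bsub>St2\<^esub> h a) \<otimes>\<^bsub>St2\<^esub> (x (- b) \<otimes>\<^bsub>St2\<^esub> h b) \<otimes>\<^bsub>St2\<^esub> x t
    = x (- a - a\<^sup>2 * b) \<otimes>\<^bsub>St2\<^esub> ((h a \<otimes>\<^bsub>St2\<^esub> h b) \<otimes>\<^bsub>St2\<^esub> x t)"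
    using assms(1,2) by (simp add: St.m_assoc St.h_x_left St.xy_add)
  also have "\<dots> = (x (- a - a\<^sup>2 * b) \<otimes>\<^bsub>St2\<^esub> St_c a b) \<otimes>\<^bsub>St2\<^esub> (h (a * b) \<otimes>\<^bsub>St2\<^esub> x t)"
    using c by (simp add: h_mult_h St.m_assoc)
  also have "x (- a - a\<^sup>2 * b) \<otimes>\<^bsub>St2\<^esub> St_c a b = St_c a b \<otimes>\<^bsub>St2\<^esub> x (- a - a\<^sup>2 * b)"
    using central by simp
  also have "\<dots> \<otimes>\<^bsub>St2\<^esub> (h (a * b) \<otimes>\<^bsub>St2\<^esub> x t) = St_c a b \<otimes>\<^bsub>St2\<^esub> (x (- (a * b)) \<otimes>\<^bsub>St2\<^esub> h (a * b))"
    using assms(1,2) c(1) t by (simp add: St.m_assoc St.h_x St.xy_add)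
  finally show ?thesis .
qed

lemma H2_to_K2_C_class:
  assumes "a \<noteq> 0" "b \<noteq> 0" "l \<noteq> 0" "l \<noteq> 1" "l \<noteq> - 1"
  shows "H2_to_K2 s (C_class a b l) = St_c a b"
  unfolding C_class_def H2_to_K2_eq[OF lifts_F_cycle[OF assms]] symbol_eq[OF assms(1,2)]
  by (rule defect_product_diff_frag_of[OF St_c_in_K2_2[OF assms(1,2)]]) simp

lemma H2_to_K2_C_tilde_class:
  assumes "a \<noteq> 0" "b \<noteq> 0" "l \<noteq> 0" "l \<noteq> 1" "l \<noteq> - 1" "a \<notin> {1, - 1}" "b \<notin> {1, - 1}" "a * b \<notin> {1, - 1}"
  shows "H2_to_K2 s (C_tilde_class a b l) = St_c a b"
  unfolding C_tilde_class_def H2_to_K2_eq[OF lifts_F_tilde_cycle[OF assms]] h_mult_h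
  by (rule defect_product_diff_frag_of[OF St_c_in_K2_2[OF assms(1,2)]]) simp

end

theorem theorem7p8:
  fixes l :: "'a::field" and s :: "'a ^ 2 ^ 2 \<Rightarrow> (root \<times> 'a) word set"
  assumes "infinite (UNIV :: 'a set) \<or> card (UNIV :: 'a set) \<ge> 4"
    and "l \<noteq> 0" and "l \<noteq> 1" and "l \<noteq> - 1"
    and "is_section s"
  shows "(\<forall>a b. a \<noteq> 0 \<longrightarrow> b \<noteq> 0 \<longrightarrow> H2_to_K2 s (C_class a b l) = St_c a b)
       \<and> (\<forall>a b. a \<noteq> 0 \<longrightarrow> b \<noteq> 0 \<longrightarrow> a \<notin> {1, - 1} \<longrightarrow> b \<notin> {1, - 1} \<longrightarrow> a * b \<notin> {1, - 1}
              \<longrightarrow> H2_to_K2 s (C_tilde_class a b l) = St_c a b)"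
proof -
  interpret steinberg_section s
    by unfold_locales (rule assms(5))
  show ?thesis
    by (intro conjI allI impI H2_to_K2_C_class H2_to_K2_C_tilde_class assms(2-4))
qed

end
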